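(* Let $K\ge1$ be fixed and consider the $K$-class stochastic block model on $n$ nodes: labels $Z_1,\dots,Z_n$ are i.i.d. on $\{1,\dots,K\}$ with probability vector $\pi=(\pi_1,\dots,\pi_K)$, and given $Z$ the edges $A_{ij}=A_{ji}$, $i<j$, are independent Bernoulli$(P_{Z_iZ_j})$ variables, $A_{ii}=0$, where $P$ is a symmetric $K\times K$ matrix with entries in $[0,1]$. Fix $\alpha,\beta_1,\beta_2>0$ and let $\widehat e$ be any maximizer over $e\in\{1,\dots,K\}^n$ of the Bayesian modularity $Q_B(e)$ defined in the context. (i) If $(P,\pi)$ is fixed (not depending on $n$) and identifiable, with $0<P_{ab}<1$ for all $a,b$ and $\pi_a>0$ for all $a$, then $\widehat e$ is strongly consistent. (ii) If $P=\rho_n S$, where $\rho_n>0$ are numbers with $\rho_n S_{ab}\le 1$ and $(S,\pi)$ is fixed and identifiable with $S_{ab}>0$ for all $a,b$ and $\pi_a>0$ for all $a$, then $\widehat e$ is strongly consistent provided $\lambda_n/(\log n)^2\to\infty$, where $\lambda_n=(n-1)\sum_{a,b}\pi_a\pi_bP_{ab}$.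
   Context: For a labelling $e\in\{1,\dots,K\}^n$ and $a,b\in\{1,\dots,K\}$: $n_a(e)=\#\{i:e_i=a\}$; $O_{ab}(e)=\sum_{i,j}A_{ij}1\{e_i=a,e_j=b\}$ if $a\ne b$ and $O_{aa}(e)=\sum_{i<j}A_{ij}1\{e_i=a,e_j=a\}$; $n_{ab}(e)=n_a(e)n_b(e)$ if $a\ne b$ and $n_{aa}(e)=\tfrac12 n_a(e)(n_a(e)-1)$. The Bayesian modularity is $Q_B(e)=\frac1{n^2}\sum_{1\le a\le b\le K}\log B\big(O_{ab}(e)+\beta_1,\,n_{ab}(e)-O_{ab}(e)+\beta_2\big)+\frac1{n^2}\sum_{a=1}^K\log\Gamma(n_a(e)+\alpha)$, with $B$ the beta function (it is the log posterior of $e$ given $A$ up to an $e$-free constant, under a Dirichlet$(\alpha,\dots,\alpha)$ prior on $\pi$ and i.i.d. Beta$(\beta_1,\beta_2)$ priors on $P_{ab}$, $a\le b$). For labellings $e,c$ define the $K\times K$ matrix $R(e,c)_{ab}=\frac1n\sum_i1\{e_i=a,c_i=b\}$ and the vector $f(c)_a=n_a(c)/n$. For a permutation $\sigma$ of $\{1,\dots,K\}$, $P_\sigma$ is the permutation matrix whose rows are $e_{\sigma(1)}^T,\dots,e_{\sigma(K)}^T$ (unit vectors). $\widehat e$ is strongly consistent if $\Pr\big(P_\sigma R(\widehat e,Z)={\rm Diag}(f(Z))\text{ for some permutation }\sigma\big)\to1$ as $n\to\infty$. The pair $(P,\pi)$ is identifiable if the rows of $P$ are pairwise different after deleting the columns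 corresponding to zero coordinates of $\pi$. *)

theory Defs
  imports "HOL-Probability.Probability"
begin

definition labellings :: "nat \<Rightarrow> nat \<Rightarrow> (nat \<Rightarrow> nat) set" where
  "labellings K n = {e. (\<forall>i<n. e i \<in> {1..K}) \<and> (\<forall>i. n \<le> i \<longrightarrow> e i = 0)}"

(* An edge configuration: E (i,j) for i < j < n is the indicator of edge {i,j};
   E is False outside.  The adjacency matrix A_ij (symmetric, zero diagonal). *)
definition adj :: "(nat \<times> nat \<Rightarrow> bool) \<Rightarrow> nat \<Rightarrow> nat \<Rightarrow> real" where
  "adj E i j = (if i < j then (if E (i, j) then 1 else 0)
                else if j < i then (if E (j, i) then 1 else 0) else 0)"

definition sbm_pmf ::
  "nat pmf \<Rightarrow> (nat \<Rightarrow> nat \<Rightarrow> real) \<Rightarrow> nat \<Rightarrow> ((nat \<Rightarrow> nat) \<times> (nat \<times> nat \<Rightarrow> bool)) pmf" where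
  "sbm_pmf \<pi> P n =
     do { Z \<leftarrow> Pi_pmf {..<n} 0 (\<lambda>_. \<pi>);
          E \<leftarrow> Pi_pmf {(i, j). i < j \<and> j < n} False
                 (\<lambda>(i, j). bernoulli_pmf (P (Z i) (Z j)));
          return_pmf (Z, E) }"

definition n_cnt :: "nat \<Rightarrow> (nat \<Rightarrow> nat) \<Rightarrow> nat \<Rightarrow> nat" where
  "n_cnt n e a = card {i. i < n \<and> e i = a}"

definition O_cnt :: "nat \<Rightarrow> (nat \<times> nat \<Rightarrow> bool) \<Rightarrow> (nat \<Rightarrow> nat) \<Rightarrow> nat \<Rightarrow> nat \<Rightarrow> real" where
  "O_cnt n E e a b =
     (if a \<noteq> b then (\<Sum>i<n. \<Sum>j<n. adj E i j * (if e i = a \<and> e j = b then 1 else 0))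
      else (\<Sum>j<n. \<Sum>i<j. adj E i j * (if e i = a \<and> e j = a then 1 else 0)))"

definition npair :: "nat \<Rightarrow> (nat \<Rightarrow> nat) \<Rightarrow> nat \<Rightarrow> nat \<Rightarrow> real" where
  "npair n e a b =
     (if a \<noteq> b then real (n_cnt n e a) * real (n_cnt n e b)
      else real (n_cnt n e a) * (real (n_cnt n e a) - 1) / 2)"

definition QB :: "nat \<Rightarrow> real \<Rightarrow> real \<Rightarrow> real \<Rightarrow> nat \<Rightarrow> (nat \<times> nat \<Rightarrow> bool) \<Rightarrow> (nat \<Rightarrow> nat) \<Rightarrow> real" where
  "QB K \<alpha> \<beta>1 \<beta>2 n E e =
     1 / (real n)^2 * (\<Sum>(a, b) \<in> {(a, b). 1 \<le> a \<and> a \<le> b \<and> b \<le> K}.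
          ln (Beta (O_cnt n E e a b + \<beta>1) (npair n e a b - O_cnt n E e a b + \<beta>2)))
     + 1 / (real n)^2 * (\<Sum>a = 1..K. ln (Gamma (real (n_cnt n e a) + \<alpha>)))"

definition QB_maximizer ::
  "nat \<Rightarrow> real \<Rightarrow> real \<Rightarrow> real \<Rightarrow> (nat \<Rightarrow> (nat \<times> nat \<Rightarrow> bool) \<Rightarrow> (nat \<Rightarrow> nat)) \<Rightarrow> bool" where
  "QB_maximizer K \<alpha> \<beta>1 \<beta>2 est \<longleftrightarrow>
     (\<forall>n E. est n E \<in> labellings K n \<and>
        (\<forall>e \<in> labellings K n. QB K \<alpha> \<beta>1 \<beta>2 n E e \<le> QB K \<alpha> \<beta>1 \<beta>2 n E (est n E)))"

definition Rmat :: "nat \<Rightarrow> (nat \<Rightarrow> nat) \<Rightarrow> (nat \<Rightarrow> nat) \<Rightarrow> nat \<Rightarrow> nat \<Rightarrow> real" where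
  "Rmat n e c a b = real (card {i. i < n \<and> e i = a \<and> c i = b}) / real n"

definition fvec :: "nat \<Rightarrow> (nat \<Rightarrow> nat) \<Rightarrow> nat \<Rightarrow> real" where
  "fvec n c a = real (n_cnt n c a) / real n"

(* P_sigma R(e,c) = Diag(f(c)); (P_sigma R)_{ab} = R_{sigma(a), b} *)
definition perm_diag :: "nat \<Rightarrow> nat \<Rightarrow> (nat \<Rightarrow> nat) \<Rightarrow> (nat \<Rightarrow> nat) \<Rightarrow> bool" where
  "perm_diag K n e c \<longleftrightarrow>
     (\<exists>\<sigma>. \<sigma> permutes {1..K} \<and>
        (\<forall>a\<in>{1..K}. \<forall>b\<in>{1..K}. Rmat n e c (\<sigma> a) b = (if a = b then fvec n c a else 0)))"

definition strongly_consistent ::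
  "nat \<Rightarrow> nat pmf \<Rightarrow> (nat \<Rightarrow> nat \<Rightarrow> nat \<Rightarrow> real) \<Rightarrow> (nat \<Rightarrow> (nat \<times> nat \<Rightarrow> bool) \<Rightarrow> (nat \<Rightarrow> nat)) \<Rightarrow> bool" where
  "strongly_consistent K \<pi> Pn est \<longleftrightarrow>
     ((\<lambda>n. measure_pmf.prob (sbm_pmf \<pi> (Pn n) n) {(Z, E). perm_diag K n (est n E) Z}) \<longlonglongrightarrow> 1)"

definition identifiable :: "nat \<Rightarrow> (nat \<Rightarrow> nat \<Rightarrow> real) \<Rightarrow> nat pmf \<Rightarrow> bool" where
  "identifiable K P \<pi> \<longleftrightarrow>
     (\<forall>a\<in>{1..K}. \<forall>a'\<in>{1..K}. a \<noteq> a' \<longrightarrow> (\<exists>b\<in>{1..K}. pmf \<pi> b \<noteq> 0 \<and> P a b \<noteq> P a' b))"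

definition symmetric_on :: "nat \<Rightarrow> (nat \<Rightarrow> nat \<Rightarrow> real) \<Rightarrow> bool" where
  "symmetric_on K P \<longleftrightarrow> (\<forall>a\<in>{1..K}. \<forall>b\<in>{1..K}. P a b = P b a)"

end

theory Submission
  imports Defs "HOL-Real_Asymp.Real_Asymp"
begin

text \<open>The Bayesian modularity of a labelling \<open>e\<close> is, up to factors polynomial in \<open>n\<close>, the likelihood
  of \<open>e\<close> maximised over connectivity matrices. If it beats the true labelling \<open>Z\<close>, then some \<open>q\<close> from a
  polynomial-size grid has a likelihood ratio against the truth of at least \<open>n\<close> to the power
  \<open>- C d\<close>, where \<open>d\<close> is the number of misclassified nodes up to a permutation of the labels. By
  Markov's inequality for the square root of the ratio this has probability at most \<open>n\<close> to the
  power \<open>C d\<close> times the Hellinger affinity, which is at most \<open>exp\<close> of minus half the sum over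
  \<open>i < j\<close> of \<open>(sqrt (q (e i) (e j)) - sqrt (P (Z i) (Z j)))\<^sup>2\<close>. Identifiability bounds this sum
  below by \<open>c n \<rho> d\<close>, uniformly in \<open>q\<close>, once every class of \<open>Z\<close> has a positive fraction of the
  nodes. As \<open>n \<rho>\<close> dominates \<open>ln n\<close>, this beats the \<open>(n K) ^ d\<close> labellings at distance \<open>d\<close>.\<close>

section \<open>Beta and Gamma bounds\<close>

text \<open>The obstacle is that the best-fitting table depends on the edges and may contain entries
  0 and 1, so it cannot be treated as fixed and log-likelihood ratios against it are unbounded. Its
  entries are quotients of integers at most \<open>n\<^sup>2\<close>, which makes a polynomial grid
  exact rather than approximate. The square root removes the unboundedness: the affinity is bounded
  for all Bernoulli parameters, and its exponent is a squared distance of square roots, so that an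
  elementary triangle argument works for an arbitrary table. Such distances scale linearly: passing
  from S to \<rho> S multiplies them by \<rho>, hence the dense and the sparse regime are one
  computation, with \<rho> = 1 in the dense case. The losses from the grid and from replacing Beta
  values by likelihoods do not depend on d. They are nevertheless raised to the power d, which is
  legitimate since d \<ge> 1. Each labelling then has a bound of the form \<open>y ^ d\<close>, and
  the sum over all labellings becomes a product over the nodes.\<close>

lemma power_mult_power_le_ratio:
  fixes x :: real
  assumes "0 \<le> x" "x \<le> 1" "k \<le> m"
  shows "x ^ k * (1 - x) ^ (m - k) \<le> (real k / real m) ^ k * (1 - real k / real m) ^ (m - k)"
proof -
  consider "k = 0" | "k = m" "k \<noteq> 0" | "0 < k" "k < m"
    using assms by linarith
  then show ?thesis
  proof cases
    case 1
    then show ?thesis using assms by (simp add: power_le_one)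
  next
    case 2
    then show ?thesis using assms by (simp add: power_le_one)
  next
    case 3
    define q where "q = real k / real m"
    have q: "0 < q" "q < 1" using 3 by (auto simp: q_def)
    have exp_bound: "t ^ j \<le> exp (real j * (t - 1))" if "0 \<le> t" for t :: real and j
    proof -
      have "t ^ j \<le> exp (t - 1) ^ j"
        using that exp_ge_add_one_self[of "t - 1"] by (intro power_mono) auto
      then show ?thesis by (simp add: exp_of_nat_mult)
    qed
    have "(x / q) ^ k * ((1 - x) / (1 - q)) ^ (m - k)
        \<le> exp (real k * (x / q - 1)) * exp (real (m - k) * ((1 - x) / (1 - q) - 1))"
      using assms q by (intro mult_mono exp_bound) auto
    also have "\<dots> = exp (real k * (x / q - 1) + real (m - k) * ((1 - x) / (1 - q) - 1))"
      by (simp add: exp_add)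
    also have "real k * (x / q - 1) + real (m - k) * ((1 - x) / (1 - q) - 1) = 0"
    proof -
      have "real k = real m * q" "real (m - k) = real m * (1 - q)"
        using 3 by (auto simp: q_def of_nat_diff field_simps)
      then show ?thesis using q by (simp add: field_simps)
    qed
    finally have "(x / q) ^ k * ((1 - x) / (1 - q)) ^ (m - k) \<le> 1" by simp
    then show ?thesis using q unfolding q_def[symmetric]
      by (simp add: power_divide field_simps)
  qed
qed

text \<open>The Beta integrand is the prior weight times the binomial likelihood; the latter is
  replaced pointwise by its maximum over \<open>x\<close>, attained at \<open>k / m\<close>.\<close>

lemma Beta_le_likelihood:
  fixes \<beta>1 \<beta>2 :: real
  assumes "\<beta>1 > 0" "\<beta>2 > 0" "k \<le> m"
  shows "Beta (real k + \<beta>1) (real m - real k + \<beta>2)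
    \<le> Beta \<beta>1 \<beta>2 * ((real k / real m) ^ k * (1 - real k / real m) ^ (m - k))"
proof (rule has_integral_le)
  let ?c = "(real k / real m) ^ k * (1 - real k / real m) ^ (m - k)"
  show "((\<lambda>x. x powr (real k + \<beta>1 - 1) * (1 - x) powr (real m - real k + \<beta>2 - 1))
      has_integral Beta (real k + \<beta>1) (real m - real k + \<beta>2)) {0<..<1}"
    using has_integral_Beta_real[of "real k + \<beta>1" "real m - real k + \<beta>2"] assms
    by (simp add: has_integral_Icc_iff_Ioo)
  show "((\<lambda>x. (x powr (\<beta>1 - 1) * (1 - x) powr (\<beta>2 - 1)) * ?c) has_integral Beta \<beta>1 \<beta>2 * ?c) {0<..<1}"
    using has_integral_Beta_real[of \<beta>1 \<beta>2] assms
    by (intro has_integral_mult_left) (simp add: has_integral_Icc_iff_Ioo)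
  fix x :: real assume x: "x \<in> {0<..<1}"
  have "x powr (real k + \<beta>1 - 1) * (1 - x) powr (real m - real k + \<beta>2 - 1)
      = (x powr (\<beta>1 - 1) * (1 - x) powr (\<beta>2 - 1)) * (x ^ k * (1 - x) ^ (m - k))"
  proof -
    have "x powr (real k + \<beta>1 - 1) = x powr (\<beta>1 - 1) * x ^ k"
      using x by (simp add: powr_realpow[symmetric] powr_add[symmetric] algebra_simps)
    moreover have "(1 - x) powr (real m - real k + \<beta>2 - 1) = (1 - x) powr (\<beta>2 - 1) * (1 - x) ^ (m - k)"
      using x assms by (simp add: powr_realpow[symmetric] powr_add[symmetric] of_nat_diff algebra_simps)
    ultimately show ?thesis by simp
  qed
  also have "\<dots> \<le> (x powr (\<beta>1 - 1) * (1 - x) powr (\<beta>2 - 1)) * ?c"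
    using x assms by (intro mult_left_mono power_mult_power_le_ratio) auto
  finally show "x powr (real k + \<beta>1 - 1) * (1 - x) powr (real m - real k + \<beta>2 - 1)
      \<le> (x powr (\<beta>1 - 1) * (1 - x) powr (\<beta>2 - 1)) * ?c" .
qed

lemma fact_add_le: "fact (m + j) \<le> (fact m * real (m + j) ^ j :: real)"
proof (induction j)
  case (Suc j)
  have "(fact (m + Suc j) :: real) = real (m + Suc j) * fact (m + j)" by simp
  also have "\<dots> \<le> real (m + Suc j) * (fact m * real (m + Suc j) ^ j)"
    by (intro mult_left_mono order.trans[OF Suc.IH] power_mono) auto
  finally show ?case by (simp add: algebra_simps)
qed auto

lemma binomial_mult_power_le_1:
  fixes p :: real
  assumes "0 \<le> p" "p \<le> 1" "k \<le> m"
  shows "real (m choose k) * (p ^ k * (1 - p) ^ (m - k)) \<le> 1"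
proof -
  have "real (m choose k) * p ^ k * (1 - p) ^ (m - k)
      \<le> (\<Sum>k\<le>m. real (m choose k) * p ^ k * (1 - p) ^ (m - k))"
    by (rule member_le_sum) (use assms in auto)
  also have "\<dots> = 1"
    using binomial_ring[of p "1 - p" m] by simp
  finally show ?thesis by (simp add: mult.assoc)
qed

text \<open>A single term of the binomial expansion is at most 1, so the likelihood is at most the
  inverse binomial coefficient. At integer parameters, Beta is
  \<open>(k + C)! (m - k + C)! / (m + 2 * C + 1)!\<close>, which falls short of that inverse by at
  most the displayed power. Beta decreases in both parameters, so rounding \<open>\<beta>1\<close>
  and \<open>\<beta>2\<close> up to \<open>Suc C\<close> is harmless.\<close>

lemma likelihood_le_Beta:
  fixes \<beta>1 \<beta>2 p :: real
  assumes "\<beta>1 > 0" "\<beta>2 > 0" "\<beta>1 \<le> real (Suc C)" "\<beta>2 \<le> real (Suc C)" "k \<le> m" "0 \<le> p" "p \<le> 1"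
  shows "p ^ k * (1 - p) ^ (m - k)
    \<le> real (m + (2 * C + 1)) ^ (2 * C + 1) * Beta (real k + \<beta>1) (real m - real k + \<beta>2)"
proof -
  define D where "D = real (m + (2 * C + 1)) ^ (2 * C + 1)"
  have D: "D > 0" by (simp add: D_def)
  have "p ^ k * (1 - p) ^ (m - k) \<le> 1 / real (m choose k)"
    using binomial_mult_power_le_1[of p k m] assms by (simp add: field_simps)
  also have "\<dots> = D * (fact k * fact (m - k) / (fact m * D))"
    using assms D by (simp add: binomial_fact)
  also have "fact k * fact (m - k) / (fact m * D) \<le> fact (k + C) * fact (m - k + C) / fact (m + (2 * C + 1))"
    using fact_add_le[of m "2 * C + 1"] unfolding D_def
    by (intro frac_le mult_mono fact_mono) (auto simp del: fact_Suc)
  also have "\<dots> = Beta (real k + real (Suc C)) (real m - real k + real (Suc C))"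
  proof -
    have 1: "Gamma (real k + real (Suc C)) = fact (k + C)"
      using Gamma_fact[of "k + C", where ?'a = real] by (simp add: algebra_simps)
    have 2: "Gamma (real m - real k + real (Suc C)) = fact (m - k + C)"
      using Gamma_fact[of "m - k + C", where ?'a = real] assms by (simp add: algebra_simps of_nat_diff)
    have 3: "real k + real (Suc C) + (real m - real k + real (Suc C)) = 1 + real (m + (2 * C + 1))"
      by simp
    show ?thesis unfolding Beta_def 1 2 3 Gamma_fact ..
  qed
  also have "\<dots> \<le> Beta (real k + \<beta>1) (real m - real k + \<beta>2)"
    using assms by (intro Beta_real_mono) auto
  finally show ?thesis using D by (simp add: D_def)
qed

text \<open>A unit step multiplies \<open>Gamma (z + \<alpha>)\<close> by
  \<open>z + \<alpha>\<close>, which lies between \<open>1 / L\<close> and \<open>L\<close>. The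
  requirement \<open>1 / \<alpha> \<le> L\<close> serves the downward steps, where the factor may be
  as small as \<open>\<alpha>\<close>.\<close>

lemma Gamma_le_power_mult_Gamma:
  fixes \<alpha> L :: real
  assumes \<alpha>: "\<alpha> > 0" and L: "real n + \<alpha> \<le> L" "1 / \<alpha> \<le> L" "1 \<le> L"
    and xy: "x \<le> n" "y \<le> n" "x \<le> y + d" "y \<le> x + d"
  shows "Gamma (real x + \<alpha>) \<le> L ^ d * Gamma (real y + \<alpha>)"
proof -
  have step: "Gamma (real (Suc z) + \<alpha>) = (real z + \<alpha>) * Gamma (real z + \<alpha>)" for z
    using Gamma_plus1[of "real z + \<alpha>"] \<alpha> by (auto simp: add_ac nonpos_Ints_def)
  have pos: "Gamma (real z + \<alpha>) > 0" for z using \<alpha> by simp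
  have up: "Gamma (real (z + j) + \<alpha>) \<le> L ^ j * Gamma (real z + \<alpha>)" if "z + j \<le> n" for z j
    using that
  proof (induction j)
    case (Suc j)
    have "Gamma (real (z + Suc j) + \<alpha>) = (real (z + j) + \<alpha>) * Gamma (real (z + j) + \<alpha>)"
      using step[of "z + j"] by simp
    also have "\<dots> \<le> L * (L ^ j * Gamma (real z + \<alpha>))"
      using Suc L pos[of "z + j"] \<alpha> by (intro mult_mono) auto
    finally show ?case by simp
  qed auto
  have down: "Gamma (real z + \<alpha>) \<le> L ^ j * Gamma (real (z + j) + \<alpha>)" for z j
  proof (induction j)
    case (Suc j)
    have "1 \<le> L * \<alpha>" using L \<alpha> by (simp add: field_simps)
    also have "\<dots> \<le> L * (real (z + j) + \<alpha>)" using L \<alpha> by (intro mult_left_mono) auto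
    finally have ge1: "1 \<le> L * (real (z + j) + \<alpha>)" .
    have "Gamma (real (z + j) + \<alpha>) \<le> L * (real (z + j) + \<alpha>) * Gamma (real (z + j) + \<alpha>)"
      using mult_right_mono[OF ge1, of "Gamma (real (z + j) + \<alpha>)"] pos[of "z + j"] by simp
    also have "\<dots> = L * Gamma (real (z + Suc j) + \<alpha>)" using step[of "z + j"] by simp
    finally have "L ^ j * Gamma (real (z + j) + \<alpha>) \<le> L ^ j * (L * Gamma (real (z + Suc j) + \<alpha>))"
      using L by (intro mult_left_mono) auto
    with Suc.IH show ?case by (simp add: mult_ac)
  qed auto
  show ?thesis
  proof (cases "y \<le> x")
    case True
    have "Gamma (real x + \<alpha>) \<le> L ^ (x - y) * Gamma (real y + \<alpha>)"
      using up[of y "x - y"] True xy by simp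
    also have "\<dots> \<le> L ^ d * Gamma (real y + \<alpha>)"
      using xy L pos[of y] by (intro mult_right_mono power_increasing) auto
    finally show ?thesis .
  next
    case False
    have "Gamma (real x + \<alpha>) \<le> L ^ (y - x) * Gamma (real y + \<alpha>)"
      using down[of x "y - x"] False by simp
    also have "\<dots> \<le> L ^ d * Gamma (real y + \<alpha>)"
      using xy L pos[of y] by (intro mult_right_mono power_increasing) auto
    finally show ?thesis .
  qed
qed

section \<open>Blocks of node pairs\<close>

definition node_pairs :: "nat \<Rightarrow> (nat \<times> nat) set" where
  "node_pairs n = {(i, j). i < j \<and> j < n}"

definition class_pairs :: "nat \<Rightarrow> (nat \<times> nat) set" where
  "class_pairs K = {(a, b). 1 \<le> a \<and> a \<le> b \<and> b \<le> K}"

text \<open>The unordered label pair of a node pair, sorted so that it indexes the terms a \<le> b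
  of the modularity.\<close>

definition block :: "(nat \<Rightarrow> nat) \<Rightarrow> nat \<times> nat \<Rightarrow> nat \<times> nat" where
  "block e = (\<lambda>(i, j). (min (e i) (e j), max (e i) (e j)))"

definition edge_lik :: "real \<Rightarrow> bool \<Rightarrow> real" where
  "edge_lik x b = (if b then x else 1 - x)"

definition block_size :: "nat \<Rightarrow> (nat \<Rightarrow> nat) \<Rightarrow> nat \<times> nat \<Rightarrow> nat" where
  "block_size n e t = card {p \<in> node_pairs n. block e p = t}"

definition block_edges :: "nat \<Rightarrow> (nat \<times> nat \<Rightarrow> bool) \<Rightarrow> (nat \<Rightarrow> nat) \<Rightarrow> nat \<times> nat \<Rightarrow> nat" where
  "block_edges n E e t = card {p \<in> node_pairs n. block e p = t \<and> E p}"

lemma finite_node_pairs [simp, intro]: "finite (node_pairs n)"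
  by (rule finite_subset[of _ "{..<n} \<times> {..<n}"]) (auto simp: node_pairs_def)

lemma finite_class_pairs [simp, intro]: "finite (class_pairs K)"
  by (rule finite_subset[of _ "{1..K} \<times> {1..K}"]) (auto simp: class_pairs_def)

lemma card_node_pairs_le: "card (node_pairs n) \<le> n ^ 2"
proof -
  have "card (node_pairs n) \<le> card ({..<n} \<times> {..<n})"
    by (rule card_mono) (auto simp: node_pairs_def)
  then show ?thesis by (simp add: power2_eq_square)
qed

lemma card_class_pairs_le: "card (class_pairs K) \<le> K ^ 2"
proof -
  have "card (class_pairs K) \<le> card ({1..K} \<times> {1..K})"
    by (rule card_mono) (auto simp: class_pairs_def)
  then show ?thesis by (simp add: power2_eq_square)
qed

lemma sum_node_pairs: "(\<Sum>p\<in>node_pairs n. f p) = (\<Sum>j<n. \<Sum>i<j. f (i, j))"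
  for f :: "nat \<times> nat \<Rightarrow> 'a::comm_monoid_add"
proof -
  have "(\<Sum>p\<in>node_pairs n. f p) = (\<Sum>(j, i)\<in>(SIGMA j:{..<n}. {..<j}). f (i, j))"
    by (rule sum.reindex_bij_witness[of _ "\<lambda>(j, i). (i, j)" "\<lambda>(i, j). (j, i)"])
      (auto simp: node_pairs_def)
  then show ?thesis by (simp add: sum.Sigma)
qed

lemma sum_square_eq_sum_node_pairs:
  fixes g :: "nat \<Rightarrow> nat \<Rightarrow> 'a::comm_monoid_add"
  assumes "\<And>i. i < n \<Longrightarrow> g i i = 0"
  shows "(\<Sum>i<n. \<Sum>j<n. g i j) = (\<Sum>(i, j)\<in>node_pairs n. g i j + g j i)"
proof -
  have "(\<Sum>i<n. \<Sum>j<n. g i j) = (\<Sum>p\<in>{..<n} \<times> {..<n}. g (fst p) (snd p))"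
    by (simp add: sum.cartesian_product case_prod_unfold)
  also have "\<dots> = (\<Sum>p\<in>node_pairs n \<union> prod.swap ` node_pairs n. g (fst p) (snd p))"
  proof (rule sum.mono_neutral_right)
    show "\<forall>p\<in>{..<n} \<times> {..<n} - (node_pairs n \<union> prod.swap ` node_pairs n). g (fst p) (snd p) = 0"
    proof
      fix p assume p: "p \<in> {..<n} \<times> {..<n} - (node_pairs n \<union> prod.swap ` node_pairs n)"
      obtain i j where ij: "p = (i, j)" by (cases p)
      with p have "i < n" "i = j"
        by (cases i j rule: linorder_cases; force simp: node_pairs_def image_iff)+
      then show "g (fst p) (snd p) = 0" using assms ij by simp
    qed
  qed (auto simp: node_pairs_def)
  also have "\<dots> = (\<Sum>p\<in>node_pairs n. g (fst p) (snd p)) + (\<Sum>p\<in>prod.swap ` node_pairs n. g (fst p) (snd p))"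
    by (rule sum.union_disjoint) (simp_all, auto simp: node_pairs_def)
  also have "(\<Sum>p\<in>prod.swap ` node_pairs n. g (fst p) (snd p)) = (\<Sum>p\<in>node_pairs n. g (snd p) (fst p))"
    by (subst sum.reindex) (auto simp: inj_on_def)
  finally show ?thesis by (simp add: sum.distrib case_prod_unfold)
qed

lemma O_cnt_eq_block_edges:
  assumes "a \<le> b"
  shows "O_cnt n E e a b = real (block_edges n E e (a, b))"
proof -
  have "real (block_edges n E e (a, b)) = (\<Sum>p\<in>node_pairs n. if block e p = (a, b) \<and> E p then 1 else 0)"
    by (simp add: block_edges_def sum.If_cases Int_def)
  also have "\<dots> = O_cnt n E e a b"
  proof (cases "a = b")
    case True
    have "(\<Sum>p\<in>node_pairs n. if block e p = (a, b) \<and> E p then 1 else 0 :: real)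
        = (\<Sum>(i, j)\<in>node_pairs n. adj E i j * (if e i = a \<and> e j = a then 1 else 0))"
      by (rule sum.cong) (use True in \<open>auto simp: node_pairs_def block_def adj_def min_def max_def split: if_splits\<close>)
    with True show ?thesis by (simp add: O_cnt_def sum_node_pairs)
  next
    case False
    have "O_cnt n E e a b = (\<Sum>(i, j)\<in>node_pairs n. adj E i j * (if e i = a \<and> e j = b then 1 else 0)
        + adj E j i * (if e j = a \<and> e i = b then 1 else 0))"
      using False by (simp add: O_cnt_def) (rule sum_square_eq_sum_node_pairs, simp add: adj_def)
    also have "\<dots> = (\<Sum>p\<in>node_pairs n. if block e p = (a, b) \<and> E p then 1 else 0)"
      by (rule sum.cong) (use False assms in \<open>auto simp: node_pairs_def block_def adj_def min_def max_def split: if_splits\<close>)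
    finally show ?thesis ..
  qed
  finally show ?thesis ..
qed

text \<open>The number of node pairs in a block is its edge count in the complete graph. This
  reduces \<open>npair\<close> to the identity already available for \<open>O_cnt\<close>.\<close>

lemma npair_eq_O_cnt: "npair n e a b = O_cnt n (\<lambda>_. True) e a b"
proof (cases "a = b")
  case False
  have cnt: "real (n_cnt n e c) = (\<Sum>i<n. if e i = c then 1 else 0)" for c
    by (simp add: n_cnt_def sum.If_cases Int_def)
  have "npair n e a b = (\<Sum>i<n. \<Sum>j<n. (if e i = a then 1 else 0) * (if e j = b then 1 else 0))"
    using False by (simp add: npair_def cnt sum_product)
  also have "\<dots> = O_cnt n (\<lambda>_. True) e a b"
    using False unfolding O_cnt_def by (auto simp: adj_def intro!: sum.cong)
  finally show ?thesis .
next
  case True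
  define c :: "nat \<Rightarrow> real" where "c i = (if e i = a then 1 else 0)" for i
  have cnt: "real (n_cnt n e a) = (\<Sum>i<n. c i)"
    by (simp add: n_cnt_def sum.If_cases Int_def c_def)
  have "real (n_cnt n e a) * real (n_cnt n e a) = (\<Sum>i<n. \<Sum>j<n. c i * c j)"
    by (simp add: cnt sum_product)
  also have "\<dots> = (\<Sum>i<n. \<Sum>j<n. (if i = j then 0 else c i * c j) + (if i = j then c i else 0))"
    by (intro sum.cong) (auto simp: c_def)
  also have "\<dots> = (\<Sum>i<n. \<Sum>j<n. (if i = j then 0 else c i * c j)) + real (n_cnt n e a)"
    by (simp add: sum.distrib cnt)
  also have "(\<Sum>i<n. \<Sum>j<n. (if i = j then 0 else c i * c j)) = (\<Sum>(i, j)\<in>node_pairs n. 2 * (c i * c j))"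
    by (subst sum_square_eq_sum_node_pairs) (auto simp: node_pairs_def intro!: sum.cong)
  also have "\<dots> = 2 * O_cnt n (\<lambda>_. True) e a a"
    by (simp add: sum_node_pairs O_cnt_def sum_distrib_left)
      (auto simp: adj_def c_def intro!: sum.cong)
  finally show ?thesis using True by (simp add: npair_def algebra_simps)
qed

lemma npair_eq_block_size:
  assumes "a \<le> b"
  shows "npair n e a b = real (block_size n e (a, b))"
  using O_cnt_eq_block_edges[OF assms, of n "\<lambda>_. True" e]
  by (simp add: npair_eq_O_cnt block_edges_def block_size_def)

lemma block_edges_le_block_size: "block_edges n E e t \<le> block_size n e t"
  unfolding block_edges_def block_size_def
  by (rule card_mono) auto

lemma block_size_le: "block_size n e t \<le> n ^ 2"
  unfolding block_size_def
  by (rule order.trans[OF card_mono card_node_pairs_le[of n]]) auto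

lemma block_in_class_pairs:
  assumes "e \<in> labellings K n" "p \<in> node_pairs n"
  shows "block e p \<in> class_pairs K"
proof -
  obtain i j where p: "p = (i, j)" by (cases p)
  with assms have "e i \<in> {1..K}" "e j \<in> {1..K}" by (auto simp: labellings_def node_pairs_def)
  then show ?thesis by (auto simp: p block_def class_pairs_def)
qed

text \<open>Edge counts per block are sufficient statistics for a table that is constant on blocks.
  The identity translates between products over node pairs, suited to independence, and products
  over blocks, suited to Beta values.\<close>

lemma prod_edge_lik_eq_prod_blocks:
  assumes "e \<in> labellings K n"
  shows "(\<Prod>p\<in>node_pairs n. edge_lik (x (block e p)) (E p))
    = (\<Prod>t\<in>class_pairs K. x t ^ block_edges n E e t * (1 - x t) ^ (block_size n e t - block_edges n E e t))"
proof -
  have "(\<Prod>p\<in>node_pairs n. edge_lik (x (block e p)) (E p))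
      = (\<Prod>t\<in>class_pairs K. \<Prod>p\<in>{p \<in> node_pairs n. block e p = t}. edge_lik (x (block e p)) (E p))"
    by (rule prod.group[symmetric]) (use block_in_class_pairs[OF assms] in auto)
  also have "\<dots> = (\<Prod>t\<in>class_pairs K. x t ^ block_edges n E e t * (1 - x t) ^ (block_size n e t - block_edges n E e t))"
  proof (rule prod.cong[OF refl])
    fix t
    let ?B = "{p \<in> node_pairs n. block e p = t}"
    have "(\<Prod>p\<in>?B. edge_lik (x (block e p)) (E p)) = (\<Prod>p\<in>?B. if E p then x t else 1 - x t)"
      by (rule prod.cong) (auto simp: edge_lik_def)
    also have "\<dots> = x t ^ card {p \<in> ?B. E p} * (1 - x t) ^ card {p \<in> ?B. \<not> E p}"
      by (simp add: prod.If_cases Int_def)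
    also have "card {p \<in> ?B. E p} = block_edges n E e t"
      by (simp add: block_edges_def conj_ac)
    also have "card {p \<in> ?B. \<not> E p} = block_size n e t - block_edges n E e t"
    proof -
      have "card {p \<in> ?B. \<not> E p} = card (?B - {p \<in> node_pairs n. block e p = t \<and> E p})"
        by (rule arg_cong[where f = card]) auto
      also have "\<dots> = card ?B - card {p \<in> node_pairs n. block e p = t \<and> E p}"
        by (rule card_Diff_subset) auto
      finally show ?thesis by (simp add: block_size_def block_edges_def)
    qed
    finally show "(\<Prod>p\<in>?B. edge_lik (x (block e p)) (E p))
        = x t ^ block_edges n E e t * (1 - x t) ^ (block_size n e t - block_edges n E e t)" .
  qed
  finally show ?thesis .
qed

section \<open>Separation of labellings\<close>

definition misfits :: "nat \<Rightarrow> (nat \<Rightarrow> nat) \<Rightarrow> (nat \<Rightarrow> nat) \<Rightarrow> (nat \<Rightarrow> nat) \<Rightarrow> nat" where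
  "misfits n \<sigma> e Z = card {i. i < n \<and> e i \<noteq> \<sigma> (Z i)}"

lemma misfits_le: "misfits n \<sigma> e Z \<le> n"
proof -
  have "misfits n \<sigma> e Z \<le> card {..<n}" unfolding misfits_def by (rule card_mono) auto
  then show ?thesis by simp
qed

text \<open>The parallelogram law gives the constant: two squared distances below
  \<open>\<delta> / 4\<close> force the third below \<open>\<delta>\<close>.\<close>

lemma sq_diff_lt_triangle:
  fixes x y z :: real
  assumes "(x - y)\<^sup>2 < \<delta> / 4" "(x - z)\<^sup>2 < \<delta> / 4"
  shows "(y - z)\<^sup>2 < \<delta>"
proof -
  have "(y - z)\<^sup>2 + ((x - y) + (x - z))\<^sup>2 = 2 * (x - y)\<^sup>2 + 2 * (x - z)\<^sup>2"
    by (simp add: power2_eq_square algebra_simps)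
  then show ?thesis using assms zero_le_power2[of "(x - y) + (x - z)"] by linarith
qed

text \<open>Pigeonhole over the \<open>K\<close> labels inside one true class.\<close>

lemma exists_plurality_label:
  assumes Z: "real (n_cnt n Z b) \<ge> \<nu> * real n" and e: "e \<in> labellings K n" and K: "K \<ge> 1"
  shows "\<exists>a\<in>{1..K}. real (card {i. i < n \<and> Z i = b \<and> e i = a}) \<ge> \<nu> / real K * real n"
proof (rule ccontr)
  assume "\<not> ?thesis"
  then have lt: "real (card {i. i < n \<and> Z i = b \<and> e i = a}) < \<nu> / real K * real n" if "a \<in> {1..K}" for a
    using that by force
  have "n_cnt n Z b = card (\<Union>a\<in>{1..K}. {i. i < n \<and> Z i = b \<and> e i = a})"
    unfolding n_cnt_def using e by (intro arg_cong[where f = card]) (auto simp: labellings_def)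
  also have "\<dots> \<le> (\<Sum>a\<in>{1..K}. card {i. i < n \<and> Z i = b \<and> e i = a})"
    by (rule card_UN_le) auto
  finally have "real (n_cnt n Z b) \<le> (\<Sum>a\<in>{1..K}. real (card {i. i < n \<and> Z i = b \<and> e i = a}))"
    unfolding of_nat_sum[symmetric] of_nat_le_iff .
  also have "\<dots> < (\<Sum>a\<in>{1..K}. \<nu> / real K * real n)"
    by (rule sum_strict_mono) (use K lt in auto)
  also have "\<dots> = \<nu> * real n" using K by simp
  finally show False using Z by simp
qed

text \<open>Each true class \<open>b\<close> has a label \<open>\<sigma> b\<close> carried by a positive fraction \<open>V b\<close> of its nodes. Unless the
  table \<open>q\<close> is off on a whole block \<open>V b \<times> V c\<close>, the map \<open>\<sigma>\<close> is a permutation, and then every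
  misclassified node is off against a whole \<open>V c\<close>, by the gap between the rows of \<open>s\<close>.\<close>
lemma block_distance_ge_misfits:
  fixes q s :: "nat \<Rightarrow> nat \<Rightarrow> real"
  assumes K: "K \<ge> 1" and Z: "Z \<in> labellings K n" and e: "e \<in> labellings K n"
    and \<delta>: "\<delta> > 0" and gap: "\<And>a a'. a \<in> {1..K} \<Longrightarrow> a' \<in> {1..K} \<Longrightarrow> a \<noteq> a' \<Longrightarrow> \<exists>c\<in>{1..K}. (s a c - s a' c)\<^sup>2 \<ge> \<delta>"
    and \<nu>: "\<nu> > 0" "\<nu> \<le> 1" and cnt: "\<And>b. b \<in> {1..K} \<Longrightarrow> real (n_cnt n Z b) \<ge> \<nu> * real n"
    and large: "\<nu> / real K * real n \<ge> 2"
    and symq: "\<And>a b. q a b = q b a" and syms: "\<And>a b. s a b = s b a"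
  shows "\<exists>\<sigma>. \<sigma> permutes {1..K} \<and>
    (\<Sum>(i, j)\<in>node_pairs n. (q (e i) (e j) - s (Z i) (Z j))\<^sup>2) \<ge> (\<nu> / real K)\<^sup>2 * \<delta> / 16 * real n * real (misfits n \<sigma> e Z)"
proof -
  define \<mu> where "\<mu> = \<nu> / real K"
  define v where "v = \<mu> * real n"
  have \<mu>: "\<mu> > 0" "\<mu> \<le> 1" using \<nu> K by (auto simp: \<mu>_def field_simps)
  have v: "v \<ge> 2" using large by (simp add: v_def \<mu>_def)
  have v0: "v \<ge> 0" using v by simp
  define g where "g i j = (q (e i) (e j) - s (Z i) (Z j))\<^sup>2" for i j
  define D where "D = (\<Sum>(i, j)\<in>node_pairs n. g i j)"
  have g0: "g i j \<ge> 0" for i j by (simp add: g_def)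
  have symg: "g j i = g i j" for i j
    unfolding g_def by (subst symq, subst syms) (rule refl)
  \<comment> \<open>The diagonal of \<open>g\<close> need not vanish but carries no node pair; it is
    erased so that the full double sum is exactly \<open>2 * D\<close>.\<close>
  define h where "h i j = (if i = j then 0 else g i j)" for i j
  have h0: "h i j \<ge> 0" for i j by (simp add: h_def g0)
  have "(\<Sum>i<n. \<Sum>j<n. h i j) = (\<Sum>(i, j)\<in>node_pairs n. h i j + h j i)"
    by (rule sum_square_eq_sum_node_pairs) (simp add: h_def)
  also have "\<dots> = (\<Sum>(i, j)\<in>node_pairs n. 2 * g i j)"
    by (rule sum.cong) (auto simp: h_def node_pairs_def symg)
  also have "\<dots> = 2 * D"
    by (simp add: D_def sum_distrib_left case_prod_unfold)
  finally have D2: "2 * D = (\<Sum>i<n. \<Sum>j<n. h i j)" ..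
  \<comment> \<open>Both cases count in this way: every node of \<open>U\<close> has at least
    \<open>w\<close> partners against which the table is off by \<open>\<delta> / 4\<close>.\<close>
  have lower: "2 * D \<ge> real (card U) * (w * \<delta> / 4)"
    if U: "U \<subseteq> {..<n}" and W: "\<And>i. i \<in> U \<Longrightarrow> \<exists>W\<subseteq>{..<n} - {i}. real (card W) \<ge> w \<and> (\<forall>j\<in>W. g i j \<ge> \<delta> / 4)"
    for U w
  proof -
    have "real (card U) * (w * \<delta> / 4) = (\<Sum>i\<in>U. w * \<delta> / 4)" by simp
    also have "\<dots> \<le> (\<Sum>i\<in>U. \<Sum>j<n. h i j)"
    proof (rule sum_mono)
      fix i assume "i \<in> U"
      then obtain W where W: "W \<subseteq> {..<n} - {i}" "real (card W) \<ge> w" "\<forall>j\<in>W. g i j \<ge> \<delta> / 4"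
        using W by blast
      have "w * \<delta> / 4 \<le> real (card W) * (\<delta> / 4)" using W \<delta> by simp
      also have "\<dots> = (\<Sum>j\<in>W. \<delta> / 4)" by simp
      also have "\<dots> \<le> (\<Sum>j\<in>W. h i j)"
        by (rule sum_mono) (use W in \<open>auto simp: h_def\<close>)
      also have "\<dots> \<le> (\<Sum>j<n. h i j)"
        by (rule sum_mono2) (use W h0 in auto)
      finally show "w * \<delta> / 4 \<le> (\<Sum>j<n. h i j)" .
    qed
    also have "\<dots> \<le> (\<Sum>i<n. \<Sum>j<n. h i j)"
      by (rule sum_mono2) (use U h0 in \<open>auto intro!: sum_nonneg\<close>)
    finally show ?thesis using D2 by simp
  qed
  have "\<forall>b\<in>{1..K}. \<exists>a. a \<in> {1..K} \<and> real (card {i. i < n \<and> Z i = b \<and> e i = a}) \<ge> v"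
    unfolding v_def \<mu>_def using exists_plurality_label[OF cnt e K] by blast
  from bchoice[OF this] obtain \<sigma> where "\<forall>b\<in>{1..K}. \<sigma> b \<in> {1..K} \<and> real (card {i. i < n \<and> Z i = b \<and> e i = \<sigma> b}) \<ge> v"
    by blast
  then have \<sigma>: "\<And>b. b \<in> {1..K} \<Longrightarrow> \<sigma> b \<in> {1..K}"
    "\<And>b. b \<in> {1..K} \<Longrightarrow> real (card {i. i < n \<and> Z i = b \<and> e i = \<sigma> b}) \<ge> v"
    by blast+
  define V where "V b = {i. i < n \<and> Z i = b \<and> e i = \<sigma> b}" for b
  have V: "V b \<subseteq> {..<n}" "finite (V b)" for b by (auto simp: V_def)
  have cardV: "real (card (V b)) \<ge> v" if "b \<in> {1..K}" for b using \<sigma>(2)[OF that] by (simp add: V_def)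
  show ?thesis
  proof (cases "\<forall>b\<in>{1..K}. \<forall>c\<in>{1..K}. (q (\<sigma> b) (\<sigma> c) - s b c)\<^sup>2 < \<delta> / 4")
    case False
    then obtain b c where bc: "b \<in> {1..K}" "c \<in> {1..K}" "(q (\<sigma> b) (\<sigma> c) - s b c)\<^sup>2 \<ge> \<delta> / 4"
      by force
    \<comment> \<open>For \<open>b = c\<close> the node \<open>i\<close> itself lies in
      \<open>V c\<close> and must be removed; \<open>v \<ge> 2\<close> turns the loss of one node
      into at most the factor 1/2.\<close>
    have "2 * D \<ge> real (card (V b)) * (v / 2 * \<delta> / 4)"
    proof (rule lower[OF V(1)])
      fix i assume i: "i \<in> V b"
      have "real (card (V c - {i})) \<ge> real (card (V c)) - 1"
        using V(2)[of c] by (cases "i \<in> V c") (auto simp: card_Diff_singleton_if of_nat_diff)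
      then have "real (card (V c - {i})) \<ge> v / 2" using cardV[OF bc(2)] v by linarith
      then show "\<exists>W\<subseteq>{..<n} - {i}. real (card W) \<ge> v / 2 \<and> (\<forall>j\<in>W. g i j \<ge> \<delta> / 4)"
        using i V(1)[of c] bc(3) by (intro exI[of _ "V c - {i}"]) (auto simp: g_def V_def)
    qed
    moreover have "real (card (V b)) * (v / 2 * \<delta> / 4) \<ge> v * (v / 2 * \<delta> / 4)"
      using cardV[OF bc(1)] v0 \<delta> by (intro mult_right_mono) auto
    ultimately have D: "v * v * \<delta> / 16 \<le> D" by simp
    \<comment> \<open>Here \<open>D\<close> is already of order \<open>n\<^sup>2\<close>, so any
      permutation will do, the number of misfits being at most \<open>n\<close>.\<close>
    have "\<mu>\<^sup>2 * \<delta> / 16 * real n * real (misfits n id e Z) \<le> \<mu>\<^sup>2 * \<delta> / 16 * real n * real n"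
      using misfits_le[of n id e Z] \<delta> by (intro mult_left_mono) auto
    also have "\<dots> = v * v * \<delta> / 16"
      by (simp add: v_def power2_eq_square)
    also note D
    finally have "D \<ge> \<mu>\<^sup>2 * \<delta> / 16 * real n * real (misfits n id e Z)" .
    then show ?thesis unfolding D_def g_def \<mu>_def using permutes_id by blast
  next
    case True
    \<comment> \<open>Two classes sharing a label would have both their rows within
      \<open>\<delta> / 4\<close> of one row of \<open>q\<close>, contradicting the gap.\<close>
    have "inj_on \<sigma> {1..K}"
    proof (rule inj_onI, rule ccontr)
      fix b b' assume b: "b \<in> {1..K}" "b' \<in> {1..K}" "\<sigma> b = \<sigma> b'" "b \<noteq> b'"
      then obtain c where c: "c \<in> {1..K}" "(s b c - s b' c)\<^sup>2 \<ge> \<delta>" using gap by blast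
      have "(q (\<sigma> b) (\<sigma> c) - s b c)\<^sup>2 < \<delta> / 4" "(q (\<sigma> b) (\<sigma> c) - s b' c)\<^sup>2 < \<delta> / 4"
        using True b c by force+
      from sq_diff_lt_triangle[OF this] c show False by simp
    qed
    moreover from this have surj: "\<sigma> ` {1..K} = {1..K}"
      using \<sigma>(1) by (intro endo_inj_surj) auto
    ultimately have bij: "bij_betw \<sigma> {1..K} {1..K}" by (simp add: bij_betw_def)
    define \<tau> where "\<tau> b = (if b \<in> {1..K} then \<sigma> b else b)" for b
    have "bij_betw \<tau> {1..K} {1..K}"
      using bij by (rule iffD1[OF bij_betw_cong, rotated]) (simp add: \<tau>_def)
    then have perm: "\<tau> permutes {1..K}"
      by (rule bij_imp_permutes) (auto simp: \<tau>_def)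
    define U where "U = {i. i < n \<and> e i \<noteq> \<tau> (Z i)}"
    have "2 * D \<ge> real (card U) * (v * \<delta> / 4)"
    proof (rule lower)
      show "U \<subseteq> {..<n}" by (auto simp: U_def)
      fix i assume i: "i \<in> U"
      then have lab: "Z i \<in> {1..K}" "e i \<in> {1..K}" using Z e by (auto simp: U_def labellings_def)
      \<comment> \<open>Surjectivity assigns the wrong label of \<open>i\<close> to a class
        \<open>b'\<close> other than \<open>Z i\<close>. In the column where these two rows of
        \<open>s\<close> differ, \<open>q\<close> is close to row \<open>b'\<close> and hence far
        from row \<open>Z i\<close>.\<close>
      from lab(2) have "e i \<in> \<sigma> ` {1..K}" by (simp only: surj)
      then obtain b' where b': "b' \<in> {1..K}" "e i = \<sigma> b'" by blast
      with i lab have "b' \<noteq> Z i" by (auto simp: U_def \<tau>_def)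
      then obtain c where c: "c \<in> {1..K}" "(s (Z i) c - s b' c)\<^sup>2 \<ge> \<delta>" using gap lab b' by metis
      have "(q (e i) (\<sigma> c) - s b' c)\<^sup>2 < \<delta> / 4" using True b' c by auto
      then have far: "(q (e i) (\<sigma> c) - s (Z i) c)\<^sup>2 \<ge> \<delta> / 4"
        using sq_diff_lt_triangle[of "q (e i) (\<sigma> c)" "s (Z i) c" \<delta> "s b' c"] c by force
      \<comment> \<open>Nodes of \<open>V c\<close> are correctly labelled, so the misfit
        \<open>i\<close> is not among them and all of \<open>V c\<close> can be used.\<close>
      have "i \<notin> V c" using i c by (auto simp: U_def V_def \<tau>_def)
      then show "\<exists>W\<subseteq>{..<n} - {i}. real (card W) \<ge> v \<and> (\<forall>j\<in>W. g i j \<ge> \<delta> / 4)"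
        using V(1)[of c] cardV[OF c(1)] far by (intro exI[of _ "V c"]) (auto simp: g_def V_def)
    qed
    then have D: "\<mu> * \<delta> / 8 * real n * real (card U) \<le> D" by (simp add: v_def algebra_simps)
    \<comment> \<open>The bound of this case is stronger; it is weakened to the constant of the
      other case.\<close>
    have "\<mu>\<^sup>2 \<le> \<mu> * 2" using \<mu> by (simp add: power2_eq_square)
    then have "\<mu>\<^sup>2 * \<delta> / 16 \<le> \<mu> * \<delta> / 8" using \<delta> by (simp add: field_simps)
    then have "\<mu>\<^sup>2 * \<delta> / 16 * real n * real (card U) \<le> \<mu> * \<delta> / 8 * real n * real (card U)"
      by (intro mult_right_mono) auto
    also note D
    finally have "D \<ge> \<mu>\<^sup>2 * \<delta> / 16 * real n * real (misfits n \<tau> e Z)"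
      by (simp add: misfits_def U_def)
    then show ?thesis unfolding D_def g_def \<mu>_def using perm by blast
  qed
qed

section \<open>Probability bounds\<close>

text \<open>The first root is an exact expression in the squared distance, the second is bounded by
  the arithmetic mean. Only the edge part of the Hellinger distance survives, and this is the part
  that scales linearly with the edge density.\<close>

lemma bernoulli_affinity_le:
  fixes p q :: real
  assumes "0 \<le> p" "p \<le> 1" "0 \<le> q" "q \<le> 1"
  shows "sqrt (q * p) + sqrt ((1 - q) * (1 - p)) \<le> exp (- (sqrt q - sqrt p)\<^sup>2 / 2)"
proof -
  have "sqrt (q * p) = (q + p - (sqrt q - sqrt p)\<^sup>2) / 2"
    using assms by (simp add: power2_diff real_sqrt_mult)
  moreover have "sqrt ((1 - q) * (1 - p)) \<le> ((1 - q) + (1 - p)) / 2"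
    using assms by (intro arith_geo_mean_sqrt) auto
  ultimately have "sqrt (q * p) + sqrt ((1 - q) * (1 - p)) \<le> 1 + (- (sqrt q - sqrt p)\<^sup>2 / 2)"
    by (simp add: field_simps)
  also have "\<dots> \<le> exp (- (sqrt q - sqrt p)\<^sup>2 / 2)" by (rule exp_ge_add_one_self)
  finally show ?thesis .
qed

lemma edge_lik_nonneg: "0 \<le> x \<Longrightarrow> x \<le> 1 \<Longrightarrow> 0 \<le> edge_lik x b"
  by (simp add: edge_lik_def)

lemma pmf_bernoulli_eq_edge_lik: "0 \<le> x \<Longrightarrow> x \<le> 1 \<Longrightarrow> pmf (bernoulli_pmf x) b = edge_lik x b"
  by (cases b) (auto simp: edge_lik_def)

lemma prob_likelihood_ratio_le:
  fixes p q :: "'a \<Rightarrow> real"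
  assumes A: "finite A" and p: "\<And>x. x \<in> A \<Longrightarrow> 0 \<le> p x \<and> p x \<le> 1"
    and q: "\<And>x. x \<in> A \<Longrightarrow> 0 \<le> q x \<and> q x \<le> 1" and W: "W \<ge> 0"
  shows "measure_pmf.prob (Pi_pmf A False (\<lambda>x. bernoulli_pmf (p x)))
      {E. (\<Prod>x\<in>A. edge_lik (p x) (E x)) \<le> W * (\<Prod>x\<in>A. edge_lik (q x) (E x))}
    \<le> sqrt W * exp (- (\<Sum>x\<in>A. (sqrt (q x) - sqrt (p x))\<^sup>2) / 2)" (is "measure_pmf.prob ?M ?S \<le> _")
proof -
  define f where "f x b = sqrt (edge_lik (q x) b / edge_lik (p x) b)" for x b
  have f0: "f x b \<ge> 0" if "x \<in> A" for x b
    using p[OF that] q[OF that] by (auto simp: f_def edge_lik_nonneg intro!: divide_nonneg_nonneg)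
  have sqrt_prod: "sqrt (prod g A) = (\<Prod>x\<in>A. sqrt (g x))" for g
    using A by (induction A) (auto simp: real_sqrt_mult)
  have fin: "finite (set_pmf ?M)"
    by (rule finite_subset[OF set_Pi_pmf_subset']) (use A in auto)
  have "measure_pmf.prob ?M ?S = measure_pmf.expectation ?M (indicator ?S)" by simp
  also have "\<dots> \<le> measure_pmf.expectation ?M (\<lambda>E. sqrt W * (\<Prod>x\<in>A. f x (E x)))"
  proof (rule integral_mono_AE)
    \<comment> \<open>Only configurations in the support matter: elsewhere a factor of the true
      likelihood vanishes and the quotient in \<open>f\<close> takes the default value 0.\<close>
    show "AE E in measure_pmf ?M. indicator ?S E \<le> sqrt W * (\<Prod>x\<in>A. f x (E x))"
    proof (rule AE_pmfI)
      fix E assume E: "E \<in> set_pmf ?M"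
      have pos: "edge_lik (p x) (E x) > 0" if "x \<in> A" for x
      proof -
        have "E x \<in> set_pmf (bernoulli_pmf (p x))"
          using E that A by (auto simp: set_Pi_pmf PiE_dflt_def)
        then show ?thesis using p[OF that] by (metis pmf_bernoulli_eq_edge_lik pmf_positive)
      qed
      show "indicator ?S E \<le> sqrt W * (\<Prod>x\<in>A. f x (E x))"
      proof (cases "E \<in> ?S")
        case True
        have "1 \<le> W * (\<Prod>x\<in>A. edge_lik (q x) (E x)) / (\<Prod>x\<in>A. edge_lik (p x) (E x))"
          using True pos by (simp add: le_divide_eq prod_pos)
        then have "1 \<le> sqrt (W * (\<Prod>x\<in>A. edge_lik (q x) (E x) / edge_lik (p x) (E x)))"
          by (simp add: prod_dividef)
        also have "\<dots> = sqrt W * (\<Prod>x\<in>A. f x (E x))"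
          by (simp add: real_sqrt_mult f_def sqrt_prod)
        finally show ?thesis using True by simp
      qed (use f0 W in \<open>auto intro!: mult_nonneg_nonneg prod_nonneg\<close>)
    qed
  qed (intro integrable_measure_pmf_finite fin)+
  also have "\<dots> = sqrt W * (\<Prod>x\<in>A. measure_pmf.expectation (bernoulli_pmf (p x)) (f x))"
    using A f0 by (simp add: expectation_prod_Pi_pmf integrable_measure_pmf_finite)
  also have "\<dots> \<le> sqrt W * (\<Prod>x\<in>A. exp (- (sqrt (q x) - sqrt (p x))\<^sup>2 / 2))"
  proof (intro mult_left_mono prod_mono conjI)
    fix x assume x: "x \<in> A"
    show "0 \<le> measure_pmf.expectation (bernoulli_pmf (p x)) (f x)"
      using f0[OF x] by simp
    have aux: "sqrt (v / u) * u = sqrt (v * u)" if "u \<ge> 0" for u v :: real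
      using that by (cases "u = 0") (auto simp: real_sqrt_divide real_sqrt_mult field_simps)
    have "measure_pmf.expectation (bernoulli_pmf (p x)) (f x) = sqrt (q x * p x) + sqrt ((1 - q x) * (1 - p x))"
      using p[OF x] by (simp add: f_def edge_lik_def aux)
    also have "\<dots> \<le> exp (- (sqrt (q x) - sqrt (p x))\<^sup>2 / 2)"
      using p[OF x] q[OF x] by (intro bernoulli_affinity_le) auto
    finally show "measure_pmf.expectation (bernoulli_pmf (p x)) (f x) \<le> exp (- (sqrt (q x) - sqrt (p x))\<^sup>2 / 2)" .
  qed (use W in auto)
  also have "(\<Prod>x\<in>A. exp (- (sqrt (q x) - sqrt (p x))\<^sup>2 / 2)) = exp (- (\<Sum>x\<in>A. (sqrt (q x) - sqrt (p x))\<^sup>2) / 2)"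
    using A by (simp add: exp_sum[symmetric] sum_negf sum_divide_distrib)
  finally show ?thesis .
qed

text \<open>A Chernoff bound with weight 1/2 per node of class \<open>b\<close>. Per node the mean
  weight is \<open>1 - pmf \<pi> b / 2\<close>, at most \<open>exp (- pmf \<pi> b / 2)\<close>; a
  class smaller than a quarter of its mean gives back at most \<open>exp (pmf \<pi> b / 4)\<close>,
  because 2 is below e.\<close>

lemma prob_n_cnt_small_le:
  fixes \<pi> :: "nat pmf"
  assumes "\<nu> \<le> pmf \<pi> b / 4"
  shows "measure_pmf.prob (Pi_pmf {..<n} 0 (\<lambda>_. \<pi>)) {Z. real (n_cnt n Z b) < \<nu> * real n}
    \<le> exp (- pmf \<pi> b / 4) ^ n" (is "measure_pmf.prob ?M ?S \<le> _")
proof -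
  define f :: "nat \<Rightarrow> real" where "f x = 1 - indicator {b} x / 2" for x
  have f: "0 \<le> f x" "f x \<le> 1" for x by (auto simp: f_def indicator_def)
  have int_f: "integrable (measure_pmf \<pi>) f"
    by (rule measure_pmf.integrable_const_bound[of _ 1]) (use f in \<open>auto simp: abs_le_iff intro: order.trans\<close>)
  have Ef: "measure_pmf.expectation \<pi> f = 1 - pmf \<pi> b / 2"
  proof -
    have "integrable (measure_pmf \<pi>) (indicat_real {b})"
      by (rule integrable_real_indicator) (auto simp: measure_pmf.emeasure_eq_measure)
    then show ?thesis
      unfolding f_def by (subst Bochner_Integration.integral_diff) (auto simp: measure_pmf_single)
  qed
  have prodf: "(\<Prod>i<n. f (Z i)) = (1 / 2) ^ n_cnt n Z b" for Z
  proof -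
    have "(\<Prod>i<n. f (Z i)) = (\<Prod>i<n. if Z i = b then 1 / 2 else 1)"
      by (rule prod.cong) (auto simp: f_def)
    also have "\<dots> = (1 / 2) ^ card {i. i < n \<and> Z i = b}"
      by (simp add: prod.If_cases Int_def)
    finally show ?thesis by (simp add: n_cnt_def)
  qed
  have "measure_pmf.prob ?M ?S = measure_pmf.expectation ?M (indicator ?S)" by simp
  also have "\<dots> \<le> measure_pmf.expectation ?M (\<lambda>Z. exp (pmf \<pi> b / 4 * real n) * (\<Prod>i<n. f (Z i)))"
  proof (rule integral_mono)
    show "integrable (measure_pmf ?M) (\<lambda>Z. exp (pmf \<pi> b / 4 * real n) * (\<Prod>i<n. f (Z i)))"
      using f by (intro integrable_mult_right integrable_prod_Pi_pmf int_f) auto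
    fix Z
    show "indicator ?S Z \<le> exp (pmf \<pi> b / 4 * real n) * (\<Prod>i<n. f (Z i))"
    proof (cases "Z \<in> ?S")
      case True
      have "(2::real) ^ n_cnt n Z b \<le> exp 1 ^ n_cnt n Z b"
        using exp_ge_add_one_self[of 1] by (intro power_mono) auto
      also have "\<dots> = exp (real (n_cnt n Z b))" by (simp add: exp_of_nat_mult[symmetric])
      also have "\<dots> \<le> exp (pmf \<pi> b / 4 * real n)"
        using True mult_right_mono[OF assms, of "real n"] by simp
      finally show ?thesis using True by (simp add: prodf power_one_over field_simps)
    qed (auto simp: prodf)
  qed (rule integrable_real_indicator, auto simp: measure_pmf.emeasure_eq_measure)
  also have "\<dots> = exp (pmf \<pi> b / 4 * real n) * (1 - pmf \<pi> b / 2) ^ n"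
    using f expectation_prod_Pi_pmf[of "{..<n}" "\<lambda>_. \<pi>" "\<lambda>_. f" 0] by (simp add: int_f Ef)
  also have "\<dots> \<le> exp (pmf \<pi> b / 4 * real n) * exp (- pmf \<pi> b / 2) ^ n"
    using exp_ge_add_one_self[of "- pmf \<pi> b / 2"] pmf_le_1[of \<pi> b]
    by (intro mult_left_mono power_mono) auto
  also have "\<dots> = exp (- pmf \<pi> b / 4) ^ n"
    by (simp add: exp_of_nat_mult[symmetric] exp_add[symmetric])
  finally show ?thesis .
qed

lemma prob_bind_pmf_le:
  assumes "\<And>x. x \<in> set_pmf M \<Longrightarrow> x \<in> G \<Longrightarrow> measure_pmf.prob (f x) S \<le> \<epsilon>" and "\<epsilon> \<ge> 0"
  shows "measure_pmf.prob (bind_pmf M f) S \<le> measure_pmf.prob M (- G) + \<epsilon>"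
proof -
  have "ennreal (measure_pmf.prob (bind_pmf M f) S) = (\<integral>\<^sup>+x. emeasure (measure_pmf (f x)) S \<partial>measure_pmf M)"
    by (simp add: measure_pmf.emeasure_eq_measure[symmetric])
  also have "\<dots> \<le> (\<integral>\<^sup>+x. indicator (- G) x + ennreal \<epsilon> \<partial>measure_pmf M)"
  proof (rule nn_integral_mono_AE, rule AE_pmfI)
    fix x assume x: "x \<in> set_pmf M"
    show "emeasure (measure_pmf (f x)) S \<le> indicator (- G) x + ennreal \<epsilon>"
    proof (cases "x \<in> G")
      case True
      then show ?thesis using assms(1)[OF x True] by (simp add: measure_pmf.emeasure_eq_measure ennreal_leI)
    next
      case False
      have "emeasure (measure_pmf (f x)) S \<le> 1" by (rule measure_pmf.emeasure_le_1)
      also have "(1::ennreal) \<le> indicator (- G) x + ennreal \<epsilon>" using False by simp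
      finally show ?thesis .
    qed
  qed
  also have "\<dots> = ennreal (measure_pmf.prob M (- G) + \<epsilon>)"
    using assms(2) by (subst nn_integral_add) (auto simp: measure_pmf.emeasure_eq_measure ennreal_plus)
  finally show ?thesis using assms(2) by (subst (asm) ennreal_le_iff) auto
qed

lemma labellings_eq_PiE_dflt: "labellings K n = PiE_dflt {..<n} 0 (\<lambda>_. {1..K})"
  unfolding labellings_def PiE_dflt_def by (intro Collect_cong) (metis lessThan_iff not_less)

lemma finite_labellings [simp, intro]: "finite (labellings K n)"
  unfolding labellings_eq_PiE_dflt by (rule finite_PiE_dflt) auto

text \<open>The generating function of the number of misfits. The weight is a product over nodes
  with factor 1 for the right label and \<open>y\<close> for the others, so sum and product
  interchange. The subtracted 1 is the term of the labelling obtained from \<open>Z\<close> by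
  \<open>\<sigma>\<close>, which has no misfits.\<close>

lemma sum_power_misfits_le:
  fixes y :: real
  assumes y: "y \<ge> 0" and \<sigma>: "\<sigma> permutes {1..K}" and Z: "Z \<in> labellings K n"
  shows "(\<Sum>e\<in>{e \<in> labellings K n. misfits n \<sigma> e Z \<ge> 1}. y ^ misfits n \<sigma> e Z) \<le> (1 + real K * y) ^ n - 1"
proof -
  define w where "w i a = (if a = \<sigma> (Z i) then 1 else y)" for i a
  have pow: "y ^ misfits n \<sigma> e Z = (\<Prod>i<n. w i (e i))" for e
    by (simp add: w_def prod.If_cases misfits_def Int_def)
  have \<sigma>Z: "\<sigma> (Z i) \<in> {1..K}" if "i < n" for i
    using Z that permutes_in_image[OF \<sigma>] by (auto simp: labellings_def)
  define e0 where "e0 i = (if i < n then \<sigma> (Z i) else 0)" for i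
  have e0: "e0 \<in> labellings K n" "misfits n \<sigma> e0 Z = 0"
    using \<sigma>Z by (auto simp: e0_def labellings_def misfits_def)
  \<comment> \<open>Labellings are 0 outside the nodes whereas \<open>PiE\<close> uses
    \<open>undefined\<close>; \<open>?g\<close> translates between the two conventions.\<close>
  let ?g = "\<lambda>h i. if i \<in> {..<n} then h i else (0::nat)"
  have "(\<Sum>e\<in>labellings K n. y ^ misfits n \<sigma> e Z) = (\<Sum>e\<in>?g ` PiE {..<n} (\<lambda>_. {1..K}). \<Prod>i<n. w i (e i))"
    by (simp only: pow labellings_eq_PiE_dflt dflt_image_PiE)
  also have "\<dots> = (\<Sum>h\<in>PiE {..<n} (\<lambda>_. {1..K}). \<Prod>i<n. w i (?g h i))"
  proof (rule sum.reindex[unfolded o_def])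
    show "inj_on ?g (PiE {..<n} (\<lambda>_. {1..K}))"
    proof (rule inj_onI)
      fix h h' assume h: "h \<in> PiE {..<n} (\<lambda>_. {1..K})" "h' \<in> PiE {..<n} (\<lambda>_. {1..K})" "?g h = ?g h'"
      show "h = h'"
      proof (rule PiE_ext[OF h(1,2)])
        fix i assume "i \<in> {..<n}"
        then show "h i = h' i" using fun_cong[OF h(3), of i] by simp
      qed
    qed
  qed
  also have "\<dots> = (\<Sum>h\<in>PiE {..<n} (\<lambda>_. {1..K}). \<Prod>i<n. w i (h i))"
    by (intro sum.cong prod.cong) auto
  also have "\<dots> = (\<Prod>i<n. \<Sum>a\<in>{1..K}. w i a)"
    by (rule prod_sum_PiE[symmetric]) auto
  also have "\<dots> \<le> (\<Prod>i<n. 1 + real K * y)"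
  proof (intro prod_mono conjI)
    fix i assume "i \<in> {..<n}"
    then have i: "\<sigma> (Z i) \<in> {1..K}" using \<sigma>Z by simp
    show "0 \<le> (\<Sum>a\<in>{1..K}. w i a)" using y by (auto simp: w_def intro!: sum_nonneg)
    have "(\<Sum>a\<in>{1..K}. w i a) \<le> (\<Sum>a\<in>{1..K}. (if a = \<sigma> (Z i) then 1 else 0) + y)"
      by (rule sum_mono) (use y in \<open>auto simp: w_def\<close>)
    also have "\<dots> = 1 + real K * y" using i by (simp add: sum.distrib)
    finally show "(\<Sum>a\<in>{1..K}. w i a) \<le> 1 + real K * y" .
  qed
  also have "\<dots> = (1 + real K * y) ^ n" by simp
  finally have total: "(\<Sum>e\<in>labellings K n. y ^ misfits n \<sigma> e Z) \<le> (1 + real K * y) ^ n" .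
  have "(\<Sum>e\<in>{e \<in> labellings K n. misfits n \<sigma> e Z \<ge> 1}. y ^ misfits n \<sigma> e Z)
      \<le> (\<Sum>e\<in>labellings K n - {e0}. y ^ misfits n \<sigma> e Z)"
    by (rule sum_mono2) (use y e0 in auto)
  also have "\<dots> = (\<Sum>e\<in>labellings K n. y ^ misfits n \<sigma> e Z) - 1"
    using e0 by (simp add: sum_diff1)
  finally show ?thesis using total by simp
qed

section \<open>Bayesian modularity versus likelihood\<close>

text \<open>Up to a constant, the marginal likelihood of the graph given the labelling;
  \<open>gamma_prod\<close> is likewise the Dirichlet prior weight of the labelling. Their product
  is the exponential of \<open>n\<^sup>2\<close> times the modularity.\<close>

definition beta_prod :: "nat \<Rightarrow> real \<Rightarrow> real \<Rightarrow> nat \<Rightarrow> (nat \<times> nat \<Rightarrow> bool) \<Rightarrow> (nat \<Rightarrow> nat) \<Rightarrow> real" where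
  "beta_prod K \<beta>1 \<beta>2 n E e = (\<Prod>t\<in>class_pairs K.
     Beta (real (block_edges n E e t) + \<beta>1) (real (block_size n e t) - real (block_edges n E e t) + \<beta>2))"

definition gamma_prod :: "nat \<Rightarrow> real \<Rightarrow> nat \<Rightarrow> (nat \<Rightarrow> nat) \<Rightarrow> real" where
  "gamma_prod K \<alpha> n e = (\<Prod>a\<in>{1..K}. Gamma (real (n_cnt n e a) + \<alpha>))"

lemma Beta_real_pos: "a > 0 \<Longrightarrow> b > 0 \<Longrightarrow> Beta a b > (0::real)"
  by (simp add: Beta_def)

lemma Beta_block_pos:
  assumes "\<beta>1 > 0" "\<beta>2 > 0"
  shows "Beta (real (block_edges n E e t) + \<beta>1) (real (block_size n e t) - real (block_edges n E e t) + \<beta>2) > 0"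
  using block_edges_le_block_size[of n E e t] assms by (intro Beta_real_pos add_nonneg_pos) auto

lemma beta_prod_pos: "\<beta>1 > 0 \<Longrightarrow> \<beta>2 > 0 \<Longrightarrow> beta_prod K \<beta>1 \<beta>2 n E e > 0"
  unfolding beta_prod_def by (intro prod_pos ballI Beta_block_pos)

lemma gamma_prod_pos: "\<alpha> > 0 \<Longrightarrow> gamma_prod K \<alpha> n e > 0"
  unfolding gamma_prod_def by (intro prod_pos) auto

lemma QB_eq_ln:
  assumes "\<alpha> > 0" "\<beta>1 > 0" "\<beta>2 > 0"
  shows "QB K \<alpha> \<beta>1 \<beta>2 n E e = 1 / (real n)\<^sup>2 * ln (beta_prod K \<beta>1 \<beta>2 n E e * gamma_prod K \<alpha> n e)"
proof -
  have "ln (beta_prod K \<beta>1 \<beta>2 n E e) = (\<Sum>t\<in>class_pairs K.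
     ln (Beta (real (block_edges n E e t) + \<beta>1) (real (block_size n e t) - real (block_edges n E e t) + \<beta>2)))"
    unfolding beta_prod_def
    by (intro ln_prod finite_class_pairs less_imp_neq[THEN not_sym] Beta_block_pos assms)
  also have "\<dots> = (\<Sum>(a, b)\<in>{(a, b). 1 \<le> a \<and> a \<le> b \<and> b \<le> K}.
          ln (Beta (O_cnt n E e a b + \<beta>1) (npair n e a b - O_cnt n E e a b + \<beta>2)))"
    unfolding class_pairs_def
    by (rule sum.cong) (auto simp: O_cnt_eq_block_edges npair_eq_block_size)
  finally have beta: "ln (beta_prod K \<beta>1 \<beta>2 n E e) = \<dots>" .
  have gamma: "ln (gamma_prod K \<alpha> n e) = (\<Sum>a = 1..K. ln (Gamma (real (n_cnt n e a) + \<alpha>)))"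
    unfolding gamma_prod_def
    by (intro ln_prod finite_atLeastAtMost less_imp_neq[THEN not_sym] Gamma_real_pos add_nonneg_pos)
      (use assms in auto)
  show ?thesis
    using beta_prod_pos[OF assms(2,3), of K n E e] gamma_prod_pos[OF assms(1), of K n e]
    by (simp add: QB_def ln_mult beta gamma distrib_left)
qed

lemma QB_le_iff:
  assumes "\<alpha> > 0" "\<beta>1 > 0" "\<beta>2 > 0" "n > 0"
  shows "QB K \<alpha> \<beta>1 \<beta>2 n E Z \<le> QB K \<alpha> \<beta>1 \<beta>2 n E e \<longleftrightarrow>
    beta_prod K \<beta>1 \<beta>2 n E Z * gamma_prod K \<alpha> n Z \<le> beta_prod K \<beta>1 \<beta>2 n E e * gamma_prod K \<alpha> n e"
proof -
  have pos: "beta_prod K \<beta>1 \<beta>2 n E f * gamma_prod K \<alpha> n f > 0" for f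
    using assms by (intro mult_pos_pos beta_prod_pos gamma_prod_pos)
  have "1 / (real n)\<^sup>2 > 0" using assms by simp
  then show ?thesis
    unfolding QB_eq_ln[OF assms(1-3)] using pos by (simp only: mult_le_cancel_left_pos ln_le_cancel_iff)
qed

lemma n_cnt_le_n_cnt_permuted:
  assumes \<sigma>: "\<sigma> permutes {1..K}"
  shows "n_cnt n e (\<sigma> a) \<le> n_cnt n Z a + misfits n \<sigma> e Z"
    and "n_cnt n Z a \<le> n_cnt n e (\<sigma> a) + misfits n \<sigma> e Z"
proof -
  have inj: "\<sigma> x = \<sigma> y \<longleftrightarrow> x = y" for x y using permutes_inj[OF \<sigma>] by (auto simp: inj_def)
  let ?X = "{i. i < n \<and> e i = \<sigma> a}" and ?Y = "{i. i < n \<and> Z i = a}" and ?M = "{i. i < n \<and> e i \<noteq> \<sigma> (Z i)}"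
  have "card ?X \<le> card (?Y \<union> ?M)" by (rule card_mono) (auto simp: inj)
  also have "\<dots> \<le> card ?Y + card ?M" by (rule card_Un_le)
  finally show "n_cnt n e (\<sigma> a) \<le> n_cnt n Z a + misfits n \<sigma> e Z" by (simp add: n_cnt_def misfits_def)
  have "card ?Y \<le> card (?X \<union> ?M)" by (rule card_mono) auto
  also have "\<dots> \<le> card ?X + card ?M" by (rule card_Un_le)
  finally show "n_cnt n Z a \<le> n_cnt n e (\<sigma> a) + misfits n \<sigma> e Z" by (simp add: n_cnt_def misfits_def)
qed

lemma n_cnt_le: "n_cnt n e a \<le> n"
proof -
  have "n_cnt n e a \<le> card {..<n}" unfolding n_cnt_def by (rule card_mono) auto
  then show ?thesis by simp
qed

text \<open>The product over all classes is invariant under relabelling, so class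
  \<open>\<sigma> a\<close> of \<open>e\<close> can be compared with class \<open>a\<close> of
  \<open>Z\<close>. Their sizes differ by at most the number of misfits, and each misfit costs a
  factor \<open>L\<close> in each of the \<open>K\<close> classes.\<close>

lemma gamma_prod_le:
  assumes \<alpha>: "\<alpha> > 0" and L: "real n + \<alpha> \<le> L" "1 / \<alpha> \<le> L" "1 \<le> L" and \<sigma>: "\<sigma> permutes {1..K}"
  shows "gamma_prod K \<alpha> n e \<le> (L ^ K) ^ misfits n \<sigma> e Z * gamma_prod K \<alpha> n Z"
proof -
  have "gamma_prod K \<alpha> n e = (\<Prod>a\<in>{1..K}. Gamma (real (n_cnt n e (\<sigma> a)) + \<alpha>))"
    unfolding gamma_prod_def by (rule prod.permute[OF \<sigma>, unfolded o_def])
  also have "\<dots> \<le> (\<Prod>a\<in>{1..K}. L ^ misfits n \<sigma> e Z * Gamma (real (n_cnt n Z a) + \<alpha>))"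
  proof (intro prod_mono conjI)
    fix a
    show "0 \<le> Gamma (real (n_cnt n e (\<sigma> a)) + \<alpha>)" using \<alpha> by (simp add: less_imp_le)
    show "Gamma (real (n_cnt n e (\<sigma> a)) + \<alpha>) \<le> L ^ misfits n \<sigma> e Z * Gamma (real (n_cnt n Z a) + \<alpha>)"
      using n_cnt_le_n_cnt_permuted[OF \<sigma>]
      by (intro Gamma_le_power_mult_Gamma[OF \<alpha> L] n_cnt_le)
  qed
  also have "\<dots> = (L ^ K) ^ misfits n \<sigma> e Z * gamma_prod K \<alpha> n Z"
    by (simp add: prod.distrib gamma_prod_def power_mult[symmetric] mult.commute)
  finally show ?thesis .
qed

text \<open>Used for the competing labelling: block by block, Beta is bounded by the likelihood at
  the empirical edge density. An empty block gets density 0 / 0 = 0, which is still a valid table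
  entry.\<close>

lemma beta_prod_le_likelihood:
  assumes \<beta>: "\<beta>1 > 0" "\<beta>2 > 0" and B0: "1 \<le> B0" "Beta \<beta>1 \<beta>2 \<le> B0" and e: "e \<in> labellings K n"
  shows "beta_prod K \<beta>1 \<beta>2 n E e \<le> B0 ^ (K ^ 2) *
    (\<Prod>p\<in>node_pairs n. edge_lik (real (block_edges n E e (block e p)) / real (block_size n e (block e p))) (E p))"
proof -
  define q where "q t = real (block_edges n E e t) / real (block_size n e t)" for t
  have q: "0 \<le> q t" "q t \<le> 1" for t
    using block_edges_le_block_size[of n E e t] by (auto simp: q_def divide_le_eq_1)
  define l where "l t = q t ^ block_edges n E e t * (1 - q t) ^ (block_size n e t - block_edges n E e t)" for t
  have l: "l t \<ge> 0" for t using q by (simp add: l_def)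
  have "beta_prod K \<beta>1 \<beta>2 n E e \<le> (\<Prod>t\<in>class_pairs K. B0 * l t)"
    unfolding beta_prod_def
  proof (intro prod_mono conjI)
    fix t
    show "0 \<le> Beta (real (block_edges n E e t) + \<beta>1) (real (block_size n e t) - real (block_edges n E e t) + \<beta>2)"
      using \<beta> by (intro less_imp_le Beta_block_pos)
    have "Beta (real (block_edges n E e t) + \<beta>1) (real (block_size n e t) - real (block_edges n E e t) + \<beta>2)
        \<le> Beta \<beta>1 \<beta>2 * l t"
      unfolding l_def q_def using \<beta> block_edges_le_block_size by (intro Beta_le_likelihood)
    also have "\<dots> \<le> B0 * l t" using B0 l by (intro mult_right_mono)
    finally show "Beta (real (block_edges n E e t) + \<beta>1) (real (block_size n e t) - real (block_edges n E e t) + \<beta>2)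
        \<le> B0 * l t" .
  qed
  also have "\<dots> = B0 ^ card (class_pairs K) * (\<Prod>t\<in>class_pairs K. l t)" by (simp add: prod.distrib)
  also have "\<dots> \<le> B0 ^ (K ^ 2) * (\<Prod>t\<in>class_pairs K. l t)"
    using B0 l card_class_pairs_le by (intro mult_right_mono power_increasing prod_nonneg) auto
  also have "(\<Prod>t\<in>class_pairs K. l t) = (\<Prod>p\<in>node_pairs n. edge_lik (q (block e p)) (E p))"
    unfolding l_def by (rule prod_edge_lik_eq_prod_blocks[OF e, symmetric])
  finally show ?thesis by (simp add: q_def)
qed

text \<open>The converse comparison, used for the true labelling, with \<open>x\<close> the true
  connectivity.\<close>

lemma likelihood_le_beta_prod:
  assumes \<beta>: "\<beta>1 > 0" "\<beta>2 > 0" "\<beta>1 \<le> real (Suc C)" "\<beta>2 \<le> real (Suc C)" and Z: "Z \<in> labellings K n"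
    and x: "\<And>t. t \<in> class_pairs K \<Longrightarrow> 0 \<le> x t \<and> x t \<le> 1"
  shows "(\<Prod>p\<in>node_pairs n. edge_lik (x (block Z p)) (E p))
    \<le> (real (n\<^sup>2 + (2 * C + 1)) ^ (2 * C + 1)) ^ (K ^ 2) * beta_prod K \<beta>1 \<beta>2 n E Z"
proof -
  define D where "D = real (n\<^sup>2 + (2 * C + 1)) ^ (2 * C + 1)"
  have D: "D \<ge> 1" unfolding D_def by (rule one_le_power) simp
  define b where "b t = Beta (real (block_edges n E Z t) + \<beta>1) (real (block_size n Z t) - real (block_edges n E Z t) + \<beta>2)" for t
  have b: "b t > 0" for t
    unfolding b_def using \<beta> by (intro Beta_block_pos)
  have "(\<Prod>p\<in>node_pairs n. edge_lik (x (block Z p)) (E p))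
     = (\<Prod>t\<in>class_pairs K. x t ^ block_edges n E Z t * (1 - x t) ^ (block_size n Z t - block_edges n E Z t))"
    by (rule prod_edge_lik_eq_prod_blocks[OF Z])
  also have "\<dots> \<le> (\<Prod>t\<in>class_pairs K. D * b t)"
  proof (intro prod_mono conjI)
    fix t assume t: "t \<in> class_pairs K"
    show "0 \<le> x t ^ block_edges n E Z t * (1 - x t) ^ (block_size n Z t - block_edges n E Z t)"
      using x[OF t] by simp
    have "x t ^ block_edges n E Z t * (1 - x t) ^ (block_size n Z t - block_edges n E Z t)
        \<le> real (block_size n Z t + (2 * C + 1)) ^ (2 * C + 1) * b t"
      unfolding b_def using x[OF t] \<beta> block_edges_le_block_size by (intro likelihood_le_Beta) auto
    also have "\<dots> \<le> D * b t"
      unfolding D_def using b[of t] block_size_le[of n Z t]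
      by (intro mult_right_mono power_mono) (auto simp only: of_nat_le_iff of_nat_0_le_iff add_le_mono less_imp_le)
    finally show "x t ^ block_edges n E Z t * (1 - x t) ^ (block_size n Z t - block_edges n E Z t) \<le> D * b t" .
  qed
  also have "\<dots> = D ^ card (class_pairs K) * (\<Prod>t\<in>class_pairs K. b t)" by (simp add: prod.distrib)
  also have "\<dots> \<le> D ^ (K ^ 2) * (\<Prod>t\<in>class_pairs K. b t)"
    using D b card_class_pairs_le by (intro mult_right_mono power_increasing prod_nonneg) (auto simp: less_imp_le)
  finally show ?thesis by (simp add: D_def b_def beta_prod_def)
qed

lemma likelihood_le_of_QB_le:
  assumes \<alpha>: "\<alpha> > 0" and \<beta>: "\<beta>1 > 0" "\<beta>2 > 0" "\<beta>1 \<le> real (Suc C)" "\<beta>2 \<le> real (Suc C)"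
    and B0: "1 \<le> B0" "Beta \<beta>1 \<beta>2 \<le> B0"
    and L: "real n + \<alpha> \<le> L" "1 / \<alpha> \<le> L" "1 \<le> L" and \<sigma>: "\<sigma> permutes {1..K}"
    and Z: "Z \<in> labellings K n" and e: "e \<in> labellings K n" and n: "n > 0"
    and x: "\<And>t. t \<in> class_pairs K \<Longrightarrow> 0 \<le> x t \<and> x t \<le> 1"
    and mis: "misfits n \<sigma> e Z \<ge> 1"
    and QB: "QB K \<alpha> \<beta>1 \<beta>2 n E Z \<le> QB K \<alpha> \<beta>1 \<beta>2 n E e"
  shows "(\<Prod>p\<in>node_pairs n. edge_lik (x (block Z p)) (E p))
    \<le> ((real (n\<^sup>2 + (2 * C + 1)) ^ (2 * C + 1) * B0) ^ (K ^ 2) * L ^ K) ^ misfits n \<sigma> e Z *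
      (\<Prod>p\<in>node_pairs n. edge_lik (real (block_edges n E e (block e p)) / real (block_size n e (block e p))) (E p))"
proof -
  define D where "D = real (n\<^sup>2 + (2 * C + 1)) ^ (2 * C + 1)"
  define d where "d = misfits n \<sigma> e Z"
  define l where "l = (\<Prod>p\<in>node_pairs n. edge_lik (real (block_edges n E e (block e p)) / real (block_size n e (block e p))) (E p))"
  have D: "D \<ge> 1" unfolding D_def by (rule one_le_power) simp
  have l0: "l \<ge> 0" unfolding l_def
    using block_edges_le_block_size[of n E e]
    by (intro prod_nonneg edge_lik_nonneg ballI) (auto simp: divide_le_eq_1)
  have gpos: "gamma_prod K \<alpha> n Z > 0" using \<alpha> by (rule gamma_prod_pos)
  have bpos: "beta_prod K \<beta>1 \<beta>2 n E e > 0" using \<beta>(1,2) by (rule beta_prod_pos)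
  have "beta_prod K \<beta>1 \<beta>2 n E Z * gamma_prod K \<alpha> n Z \<le> beta_prod K \<beta>1 \<beta>2 n E e * gamma_prod K \<alpha> n e"
    using QB QB_le_iff[OF \<alpha> \<beta>(1,2) n] by simp
  also have "\<dots> \<le> beta_prod K \<beta>1 \<beta>2 n E e * ((L ^ K) ^ d * gamma_prod K \<alpha> n Z)"
    unfolding d_def using bpos by (intro mult_left_mono gamma_prod_le[OF \<alpha> L \<sigma>]) auto
  finally have "beta_prod K \<beta>1 \<beta>2 n E Z \<le> beta_prod K \<beta>1 \<beta>2 n E e * (L ^ K) ^ d"
    using gpos by (simp add: mult.assoc[symmetric])
  also have "\<dots> \<le> (B0 ^ (K ^ 2) * l) * (L ^ K) ^ d"
    unfolding l_def using L by (intro mult_right_mono beta_prod_le_likelihood[OF \<beta>(1,2) B0 e]) auto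
  finally have "D ^ (K ^ 2) * beta_prod K \<beta>1 \<beta>2 n E Z \<le> D ^ (K ^ 2) * ((B0 ^ (K ^ 2) * l) * (L ^ K) ^ d)"
    using D by (intro mult_left_mono) auto
  with likelihood_le_beta_prod[OF \<beta> Z x, where E = E]
  have "(\<Prod>p\<in>node_pairs n. edge_lik (x (block Z p)) (E p)) \<le> D ^ (K ^ 2) * ((B0 ^ (K ^ 2) * l) * (L ^ K) ^ d)"
    unfolding D_def by (rule order.trans)
  also have "\<dots> = (D * B0) ^ (K ^ 2) * ((L ^ K) ^ d * l)"
    by (simp add: power_mult_distrib mult_ac)
  \<comment> \<open>The loss from the Beta comparisons occurs only once, but since it is at least 1
    and \<open>d \<ge> 1\<close> it may be charged to every misfit.\<close>
  also have "\<dots> \<le> ((D * B0) ^ (K ^ 2)) ^ d * ((L ^ K) ^ d * l)"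
  proof (intro mult_right_mono)
    have "1 \<le> D * B0" using D B0 mult_mono[of 1 D 1 B0] by simp
    then have "1 \<le> (D * B0) ^ (K ^ 2)" by (rule one_le_power)
    then show "(D * B0) ^ (K ^ 2) \<le> ((D * B0) ^ (K ^ 2)) ^ d"
      using mis unfolding d_def by (intro self_le_power) auto
  qed (use l0 L in auto)
  also have "\<dots> = ((D * B0) ^ (K ^ 2) * L ^ K) ^ d * l" by (simp add: power_mult_distrib)
  finally show ?thesis by (simp only: D_def d_def l_def)
qed

section \<open>Conditional error probability\<close>

lemma card_ratios_le:
  "card {v \<in> (\<lambda>(u, w). real u / real w) ` ({..m} \<times> {..m}). v \<le> 1} \<le> (m + 1) ^ 2"
proof -
  have "card {v \<in> (\<lambda>(u, w). real u / real w) ` ({..m} \<times> {..m}). v \<le> 1}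
      \<le> card ((\<lambda>(u, w). real u / real w) ` ({..m} \<times> {..m}))"
    by (rule card_mono) auto
  also have "\<dots> \<le> card ({..m} \<times> {..m})" by (rule card_image_le) simp
  also have "\<dots> = (m + 1) ^ 2" by (simp add: power2_eq_square)
  finally show ?thesis .
qed

lemma block_eq: "block e (i, j) = (min (e i) (e j), max (e i) (e j))"
  by (simp add: block_def)

lemma perm_diag_of_misfits_0:
  assumes \<sigma>: "\<sigma> permutes {1..K}" and "misfits n \<sigma> e Z = 0"
  shows "perm_diag K n e Z"
  unfolding perm_diag_def
proof (intro exI[of _ \<sigma>] conjI ballI \<sigma>)
  fix a b
  have eq: "e i = \<sigma> (Z i)" if "i < n" for i
    using assms(2) that unfolding misfits_def by (subst (asm) card_0_eq) auto
  have inj: "\<sigma> x = \<sigma> y \<longleftrightarrow> x = y" for x y using permutes_inj[OF \<sigma>] by (auto simp: inj_def)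
  have "{i. i < n \<and> e i = \<sigma> a \<and> Z i = b} = (if a = b then {i. i < n \<and> Z i = a} else {})"
    using eq inj by auto
  then show "Rmat n e Z (\<sigma> a) b = (if a = b then fvec n Z a else 0)"
    by (simp add: Rmat_def fvec_def n_cnt_def)
qed

text \<open>On a fixed labelling the maximised likelihood is attained on a grid of polynomially many
  connectivity matrices, so a union bound over the grid replaces the supremum, and each
  matrix is excluded by its Hellinger affinity with the truth.\<close>
lemma prob_QB_le:
  assumes K: "K \<ge> 1" and \<alpha>: "\<alpha> > 0" and \<beta>: "\<beta>1 > 0" "\<beta>2 > 0" "\<beta>1 \<le> real (Suc C)" "\<beta>2 \<le> real (Suc C)"
    and B0: "1 \<le> B0" "Beta \<beta>1 \<beta>2 \<le> B0"
    and L: "real n + \<alpha> \<le> L" "1 / \<alpha> \<le> L" "1 \<le> L"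
    and P: "\<And>a b. a \<in> {1..K} \<Longrightarrow> b \<in> {1..K} \<Longrightarrow> 0 \<le> P a b \<and> P a b \<le> 1" "symmetric_on K P"
    and \<delta>: "\<delta> > 0" and gap: "\<And>a a'. a \<in> {1..K} \<Longrightarrow> a' \<in> {1..K} \<Longrightarrow> a \<noteq> a' \<Longrightarrow>
        \<exists>c\<in>{1..K}. (sqrt (P a c) - sqrt (P a' c))\<^sup>2 \<ge> \<delta>"
    and \<nu>: "\<nu> > 0" "\<nu> \<le> 1" and cnt: "\<And>b. b \<in> {1..K} \<Longrightarrow> real (n_cnt n Z b) \<ge> \<nu> * real n"
    and large: "\<nu> / real K * real n \<ge> 2"
    and Z: "Z \<in> labellings K n" and e: "e \<in> labellings K n"
    and \<sigma>: "\<sigma> permutes {1..K}" and mis: "misfits n \<sigma> e Z \<ge> 1"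
    and minimal: "\<And>\<tau>. \<tau> permutes {1..K} \<Longrightarrow> misfits n \<sigma> e Z \<le> misfits n \<tau> e Z"
    and y: "y = real (n\<^sup>2 + 1) ^ (2 * K\<^sup>2) * ((real (n\<^sup>2 + (2 * C + 1)) ^ (2 * C + 1) * B0) ^ (K\<^sup>2) * L ^ K)
        * exp (- ((\<nu> / real K)\<^sup>2 * \<delta> / 32 * real n))"
  shows "measure_pmf.prob (Pi_pmf (node_pairs n) False (\<lambda>(i, j). bernoulli_pmf (P (Z i) (Z j))))
      {E. QB K \<alpha> \<beta>1 \<beta>2 n E Z \<le> QB K \<alpha> \<beta>1 \<beta>2 n E e} \<le> y ^ misfits n \<sigma> e Z"
proof -
  define W where "W = (real (n\<^sup>2 + (2 * C + 1)) ^ (2 * C + 1) * B0) ^ (K\<^sup>2) * L ^ K"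
  define d where "d = misfits n \<sigma> e Z"
  define \<kappa> where "\<kappa> = (\<nu> / real K)\<^sup>2 * \<delta> / 32"
  define x where "x t = P (fst t) (snd t)" for t
  \<comment> \<open>All values an empirical block density can take, including 0 / 0 = 0 for an empty
    block. The cut at 1 keeps every grid point a probability.\<close>
  define V where "V = {v \<in> (\<lambda>(u, w). real u / real w) ` ({..n\<^sup>2} \<times> {..n\<^sup>2}). v \<le> 1}"
  define Gr where "Gr = PiE (class_pairs K) (\<lambda>_. V)"
  have n: "n > 0" using large by (cases "n = 0") auto
  have W: "W \<ge> 1"
  proof -
    have "1 \<le> real (n\<^sup>2 + (2 * C + 1)) ^ (2 * C + 1)" by (rule one_le_power) simp
    then have "1 \<le> real (n\<^sup>2 + (2 * C + 1)) ^ (2 * C + 1) * B0"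
      using B0 mult_mono[of 1 _ 1 B0] by force
    then have "1 \<le> (real (n\<^sup>2 + (2 * C + 1)) ^ (2 * C + 1) * B0) ^ (K\<^sup>2)" by (rule one_le_power)
    moreover have "1 \<le> L ^ K" using L by (intro one_le_power)
    ultimately show ?thesis
      unfolding W_def using mult_mono[of 1 _ 1 "L ^ K"] by force
  qed
  have x: "0 \<le> x t \<and> x t \<le> 1" if "t \<in> class_pairs K" for t
    using that P(1) by (auto simp: x_def class_pairs_def)
  have x_sym: "x (min a b, max a b) = P a b" if "a \<in> {1..K}" "b \<in> {1..K}" for a b
    using that P(2) by (auto simp: x_def symmetric_on_def min_def max_def)
  have Zlab: "Z i \<in> {1..K}" if "i < n" for i using Z that by (auto simp: labellings_def)
  have V: "finite V" "card V \<le> (n\<^sup>2 + 1) ^ 2" "\<And>v. v \<in> V \<Longrightarrow> 0 \<le> v \<and> v \<le> 1"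
    unfolding V_def by (simp, rule card_ratios_le, auto)
  have Gr: "finite Gr" "real (card Gr) \<le> real (n\<^sup>2 + 1) ^ (2 * K\<^sup>2)"
  proof -
    show "finite Gr" unfolding Gr_def using V by (intro finite_PiE) auto
    have "card Gr = card V ^ card (class_pairs K)" by (simp add: Gr_def card_PiE)
    also have "\<dots> \<le> ((n\<^sup>2 + 1) ^ 2) ^ card (class_pairs K)" using V by (intro power_mono) auto
    also have "\<dots> \<le> ((n\<^sup>2 + 1) ^ 2) ^ (K\<^sup>2)"
      using card_class_pairs_le by (intro power_increasing) auto
    also have "\<dots> = (n\<^sup>2 + 1) ^ (2 * K\<^sup>2)" by (rule power_mult[symmetric])
    finally have "card Gr \<le> (n\<^sup>2 + 1) ^ (2 * K\<^sup>2)" .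
    then have "real (card Gr) \<le> real ((n\<^sup>2 + 1) ^ (2 * K\<^sup>2))" by (simp only: of_nat_le_iff)
    then show "real (card Gr) \<le> real (n\<^sup>2 + 1) ^ (2 * K\<^sup>2)" by (simp only: of_nat_power)
  qed
  define M where "M = Pi_pmf (node_pairs n) False (\<lambda>p. bernoulli_pmf (x (block Z p)))"
  have M: "Pi_pmf (node_pairs n) False (\<lambda>(i, j). bernoulli_pmf (P (Z i) (Z j))) = M"
    unfolding M_def
  proof (rule Pi_pmf_cong)
    fix p assume p: "p \<in> node_pairs n"
    obtain i j where ij: "p = (i, j)" by (cases p)
    have "x (block Z p) = P (Z i) (Z j)"
      unfolding ij block_eq by (rule x_sym; rule Zlab) (use p ij in \<open>auto simp: node_pairs_def\<close>)
    then show "(case p of (i, j) \<Rightarrow> bernoulli_pmf (P (Z i) (Z j))) = bernoulli_pmf (x (block Z p))"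
      by (simp add: ij)
  qed auto
  define A where "A q = {E. (\<Prod>p\<in>node_pairs n. edge_lik (x (block Z p)) (E p))
      \<le> W ^ d * (\<Prod>p\<in>node_pairs n. edge_lik (q (block e p)) (E p))}" for q
  have sub: "{E. QB K \<alpha> \<beta>1 \<beta>2 n E Z \<le> QB K \<alpha> \<beta>1 \<beta>2 n E e} \<subseteq> (\<Union>q\<in>Gr. A q)"
  proof
    fix E assume E: "E \<in> {E. QB K \<alpha> \<beta>1 \<beta>2 n E Z \<le> QB K \<alpha> \<beta>1 \<beta>2 n E e}"
    define q where "q = restrict (\<lambda>t. real (block_edges n E e t) / real (block_size n e t)) (class_pairs K)"
    have inV: "real (block_edges n E e t) / real (block_size n e t) \<in> V" for t
    proof -
      have le: "block_edges n E e t \<le> block_size n e t" "block_size n e t \<le> n\<^sup>2"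
        by (rule block_edges_le_block_size, rule block_size_le)
      have "real (block_edges n E e t) / real (block_size n e t)
          \<in> (\<lambda>(u, w). real u / real w) ` ({..n\<^sup>2} \<times> {..n\<^sup>2})"
        using le by (intro image_eqI[of _ _ "(block_edges n E e t, block_size n e t)"]) auto
      then show ?thesis unfolding V_def using le by (auto simp: divide_le_eq_1)
    qed
    have "q \<in> Gr" unfolding Gr_def q_def using inV by auto
    moreover have "E \<in> A q"
    proof -
      have "(\<Prod>p\<in>node_pairs n. edge_lik (x (block Z p)) (E p)) \<le> W ^ d *
        (\<Prod>p\<in>node_pairs n. edge_lik (real (block_edges n E e (block e p)) / real (block_size n e (block e p))) (E p))"
        unfolding W_def d_def using E
        by (intro likelihood_le_of_QB_le[OF \<alpha> \<beta> B0 L \<sigma> Z e n x mis]) auto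
      also have "(\<Prod>p\<in>node_pairs n. edge_lik (real (block_edges n E e (block e p)) / real (block_size n e (block e p))) (E p))
          = (\<Prod>p\<in>node_pairs n. edge_lik (q (block e p)) (E p))"
        by (rule prod.cong) (auto simp: q_def block_in_class_pairs[OF e])
      finally show ?thesis by (simp add: A_def)
    qed
    ultimately show "E \<in> (\<Union>q\<in>Gr. A q)" by blast
  qed
  have Aq: "measure_pmf.prob M (A q) \<le> (W * exp (- (\<kappa> * real n))) ^ d" if "q \<in> Gr" for q
  proof -
    have q01: "0 \<le> q t \<and> q t \<le> 1" if "t \<in> class_pairs K" for t
      using V(3) PiE_mem[OF \<open>q \<in> Gr\<close>[unfolded Gr_def] that] by blast
    have "measure_pmf.prob M (A q) \<le> sqrt (W ^ d) *
        exp (- (\<Sum>p\<in>node_pairs n. (sqrt (q (block e p)) - sqrt (x (block Z p)))\<^sup>2) / 2)"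
      unfolding M_def A_def
      using x q01 block_in_class_pairs[OF Z] block_in_class_pairs[OF e] W
      by (intro prob_likelihood_ratio_le) auto
    also have "\<dots> \<le> W ^ d * exp (- (\<kappa> * real n * real d))"
    proof (intro mult_mono)
      have "1 \<le> W ^ d" using W by (rule one_le_power)
      then show "sqrt (W ^ d) \<le> W ^ d"
        by (intro real_le_lsqrt) (auto simp: power2_eq_square)
      \<comment> \<open>The separation bound supplies its own permutation \<open>\<tau>\<close>,
        depending on \<open>q\<close>; minimality of \<open>\<sigma>\<close> brings the count back
        to \<open>d\<close>. Both tables are read at sorted label pairs, which makes them symmetric
        on all naturals. The constant 1/16 becomes 1/32 in \<open>\<kappa>\<close> because the
        affinity exponent is halved.\<close>
      obtain \<tau> where \<tau>: "\<tau> permutes {1..K}" and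
        ge: "(\<Sum>(i, j)\<in>node_pairs n. (sqrt (q (min (e i) (e j), max (e i) (e j)))
            - sqrt (x (min (Z i) (Z j), max (Z i) (Z j))))\<^sup>2)
          \<ge> (\<nu> / real K)\<^sup>2 * \<delta> / 16 * real n * real (misfits n \<tau> e Z)"
      proof (atomize_elim, rule block_distance_ge_misfits[OF K Z e \<delta> _ \<nu> cnt large])
        fix a a' assume "a \<in> {1..K}" "a' \<in> {1..K}" "a \<noteq> a'"
        then show "\<exists>c\<in>{1..K}. \<delta> \<le> (sqrt (x (min a c, max a c)) - sqrt (x (min a' c, max a' c)))\<^sup>2"
          using gap[of a a'] by (metis x_sym)
      qed (auto simp: min.commute max.commute)
      have "\<kappa> * 2 * real n * real d \<le> \<kappa> * 2 * real n * real (misfits n \<tau> e Z)"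
        using minimal[OF \<tau>] \<delta> by (intro mult_left_mono) (auto simp: d_def \<kappa>_def)
      also have "\<dots> \<le> (\<Sum>p\<in>node_pairs n. (sqrt (q (block e p)) - sqrt (x (block Z p)))\<^sup>2)"
        using ge by (simp add: \<kappa>_def block_def case_prod_unfold mult_ac)
      finally show "exp (- (\<Sum>p\<in>node_pairs n. (sqrt (q (block e p)) - sqrt (x (block Z p)))\<^sup>2) / 2)
          \<le> exp (- (\<kappa> * real n * real d))" by simp
    qed (use W in auto)
    also have "\<dots> = (W * exp (- (\<kappa> * real n))) ^ d"
      by (simp add: power_mult_distrib exp_of_nat_mult[symmetric] mult_ac)
    finally show ?thesis .
  qed
  define G where "G = real (n\<^sup>2 + 1) ^ (2 * K\<^sup>2)"
  have G: "G \<ge> 1" unfolding G_def by (rule one_le_power) simp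
  have "measure_pmf.prob M {E. QB K \<alpha> \<beta>1 \<beta>2 n E Z \<le> QB K \<alpha> \<beta>1 \<beta>2 n E e} \<le> measure_pmf.prob M (\<Union>q\<in>Gr. A q)"
    by (rule measure_pmf.finite_measure_mono[OF sub]) simp
  also have "\<dots> \<le> (\<Sum>q\<in>Gr. measure_pmf.prob M (A q))"
    by (rule measure_pmf.finite_measure_subadditive_finite) (use Gr in auto)
  also have "\<dots> \<le> (\<Sum>q\<in>Gr. (W * exp (- (\<kappa> * real n))) ^ d)" by (rule sum_mono) (rule Aq)
  also have "\<dots> = real (card Gr) * (W * exp (- (\<kappa> * real n))) ^ d" by simp
  also have "\<dots> \<le> G ^ d * (W * exp (- (\<kappa> * real n))) ^ d"
  proof (rule mult_right_mono)
    have "G \<le> G ^ d" using G mis by (intro self_le_power) (auto simp: d_def)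
    then show "real (card Gr) \<le> G ^ d" using Gr(2) by (simp add: G_def)
  qed (use W in simp)
  also have "\<dots> = y ^ d"
    by (simp only: y G_def W_def \<kappa>_def power_mult_distrib mult.assoc)
  finally show ?thesis unfolding M d_def .
qed

text \<open>Each wrong labelling is bounded at its best permutation. That single power of
  \<open>y\<close> is then enlarged to the sum over all permutations, so that after swapping the
  sums the generating function applies to each fixed permutation.\<close>

lemma prob_not_perm_diag_le:
  assumes K: "K \<ge> 1" and \<alpha>: "\<alpha> > 0" and \<beta>: "\<beta>1 > 0" "\<beta>2 > 0" "\<beta>1 \<le> real (Suc C)" "\<beta>2 \<le> real (Suc C)"
    and B0: "1 \<le> B0" "Beta \<beta>1 \<beta>2 \<le> B0"
    and L: "real n + \<alpha> \<le> L" "1 / \<alpha> \<le> L" "1 \<le> L"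
    and P: "\<And>a b. a \<in> {1..K} \<Longrightarrow> b \<in> {1..K} \<Longrightarrow> 0 \<le> P a b \<and> P a b \<le> 1" "symmetric_on K P"
    and \<delta>: "\<delta> > 0" and gap: "\<And>a a'. a \<in> {1..K} \<Longrightarrow> a' \<in> {1..K} \<Longrightarrow> a \<noteq> a' \<Longrightarrow>
        \<exists>c\<in>{1..K}. (sqrt (P a c) - sqrt (P a' c))\<^sup>2 \<ge> \<delta>"
    and \<nu>: "\<nu> > 0" "\<nu> \<le> 1" and cnt: "\<And>b. b \<in> {1..K} \<Longrightarrow> real (n_cnt n Z b) \<ge> \<nu> * real n"
    and large: "\<nu> / real K * real n \<ge> 2"
    and Z: "Z \<in> labellings K n"
    and est: "QB_maximizer K \<alpha> \<beta>1 \<beta>2 est"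
    and y: "y = real (n\<^sup>2 + 1) ^ (2 * K\<^sup>2) * ((real (n\<^sup>2 + (2 * C + 1)) ^ (2 * C + 1) * B0) ^ (K\<^sup>2) * L ^ K)
        * exp (- ((\<nu> / real K)\<^sup>2 * \<delta> / 32 * real n))"
  shows "measure_pmf.prob (Pi_pmf (node_pairs n) False (\<lambda>(i, j). bernoulli_pmf (P (Z i) (Z j))))
      {E. \<not> perm_diag K n (est n E) Z} \<le> real (card {\<sigma>. \<sigma> permutes {1..K}}) * ((1 + real K * y) ^ n - 1)"
    (is "measure_pmf.prob ?M _ \<le> _")
proof -
  have y0: "y \<ge> 0" using B0 L by (simp add: y)
  define S where "S = {\<sigma>. \<sigma> permutes {1..K}}"
  have S: "finite S" "S \<noteq> {}"
    unfolding S_def using permutes_id[of "{1..K}"] finite_permutations[of "{1..K}"] by blast+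
  define Bad where "Bad = {e \<in> labellings K n. \<forall>\<sigma>\<in>S. misfits n \<sigma> e Z \<ge> 1}"
  have Bad: "finite Bad" by (simp add: Bad_def)
  have best: "\<exists>\<sigma>\<in>S. \<forall>\<tau>\<in>S. misfits n \<sigma> e Z \<le> misfits n \<tau> e Z" for e
    using ex_min_if_finite[of "(\<lambda>\<sigma>. misfits n \<sigma> e Z) ` S"] S by (auto simp: not_less)
  have "measure_pmf.prob ?M {E. \<not> perm_diag K n (est n E) Z}
      \<le> measure_pmf.prob ?M (\<Union>e\<in>Bad. {E. QB K \<alpha> \<beta>1 \<beta>2 n E Z \<le> QB K \<alpha> \<beta>1 \<beta>2 n E e})"
  proof (rule measure_pmf.finite_measure_mono)
    show "{E. \<not> perm_diag K n (est n E) Z} \<subseteq> (\<Union>e\<in>Bad. {E. QB K \<alpha> \<beta>1 \<beta>2 n E Z \<le> QB K \<alpha> \<beta>1 \<beta>2 n E e})"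
    proof
      fix E assume "E \<in> {E. \<not> perm_diag K n (est n E) Z}"
      then have "misfits n \<sigma> (est n E) Z \<noteq> 0" if "\<sigma> \<in> S" for \<sigma>
        using perm_diag_of_misfits_0 that unfolding S_def by blast
      then have "est n E \<in> Bad" using est by (auto simp: Bad_def QB_maximizer_def Suc_le_eq)
      moreover have "QB K \<alpha> \<beta>1 \<beta>2 n E Z \<le> QB K \<alpha> \<beta>1 \<beta>2 n E (est n E)"
        using est Z by (auto simp: QB_maximizer_def)
      ultimately show "E \<in> (\<Union>e\<in>Bad. {E. QB K \<alpha> \<beta>1 \<beta>2 n E Z \<le> QB K \<alpha> \<beta>1 \<beta>2 n E e})" by blast
    qed
  qed simp
  also have "\<dots> \<le> (\<Sum>e\<in>Bad. measure_pmf.prob ?M {E. QB K \<alpha> \<beta>1 \<beta>2 n E Z \<le> QB K \<alpha> \<beta>1 \<beta>2 n E e})"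
    by (rule measure_pmf.finite_measure_subadditive_finite) (use Bad in auto)
  also have "\<dots> \<le> (\<Sum>e\<in>Bad. \<Sum>\<sigma>\<in>S. y ^ misfits n \<sigma> e Z)"
  proof (rule sum_mono)
    fix e assume e: "e \<in> Bad"
    obtain \<sigma> where \<sigma>: "\<sigma> \<in> S" "\<forall>\<tau>\<in>S. misfits n \<sigma> e Z \<le> misfits n \<tau> e Z" using best by blast
    have "measure_pmf.prob ?M {E. QB K \<alpha> \<beta>1 \<beta>2 n E Z \<le> QB K \<alpha> \<beta>1 \<beta>2 n E e} \<le> y ^ misfits n \<sigma> e Z"
      using e \<sigma> by (intro prob_QB_le[OF K \<alpha> \<beta> B0 L P \<delta> gap \<nu> cnt large Z _ _ _ _ y]) (auto simp: Bad_def S_def)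
    also have "\<dots> \<le> (\<Sum>\<sigma>\<in>S. y ^ misfits n \<sigma> e Z)"
      using \<sigma> S y0 by (intro member_le_sum) auto
    finally show "measure_pmf.prob ?M {E. QB K \<alpha> \<beta>1 \<beta>2 n E Z \<le> QB K \<alpha> \<beta>1 \<beta>2 n E e} \<le> (\<Sum>\<sigma>\<in>S. y ^ misfits n \<sigma> e Z)" .
  qed
  also have "\<dots> = (\<Sum>\<sigma>\<in>S. \<Sum>e\<in>Bad. y ^ misfits n \<sigma> e Z)" by (rule sum.swap)
  also have "\<dots> \<le> (\<Sum>\<sigma>\<in>S. (1 + real K * y) ^ n - 1)"
  proof (rule sum_mono)
    fix \<sigma> assume \<sigma>: "\<sigma> \<in> S"
    have "(\<Sum>e\<in>Bad. y ^ misfits n \<sigma> e Z) \<le> (\<Sum>e\<in>{e \<in> labellings K n. misfits n \<sigma> e Z \<ge> 1}. y ^ misfits n \<sigma> e Z)"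
      by (rule sum_mono2) (use y0 \<sigma> in \<open>auto simp: Bad_def\<close>)
    also have "\<dots> \<le> (1 + real K * y) ^ n - 1"
      using \<sigma> by (intro sum_power_misfits_le[OF y0 _ Z]) (simp add: S_def)
    finally show "(\<Sum>e\<in>Bad. y ^ misfits n \<sigma> e Z) \<le> (1 + real K * y) ^ n - 1" .
  qed
  finally show ?thesis by (simp add: S_def)
qed

section \<open>Consistency\<close>

lemma prob_sbm_not_perm_diag_le:
  assumes K: "K \<ge> 1" and \<pi>: "set_pmf \<pi> \<subseteq> {1..K}" and \<nu>: "\<And>b. b \<in> {1..K} \<Longrightarrow> \<nu> \<le> pmf \<pi> b / 4"
    and \<epsilon>: "\<epsilon> \<ge> 0" and cond: "\<And>Z. Z \<in> labellings K n \<Longrightarrow> (\<And>b. b \<in> {1..K} \<Longrightarrow> real (n_cnt n Z b) \<ge> \<nu> * real n) \<Longrightarrow>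
      measure_pmf.prob (Pi_pmf (node_pairs n) False (\<lambda>(i, j). bernoulli_pmf (P (Z i) (Z j))))
        {E. \<not> perm_diag K n (est n E) Z} \<le> \<epsilon>"
  shows "measure_pmf.prob (sbm_pmf \<pi> P n) {(Z, E). \<not> perm_diag K n (est n E) Z}
    \<le> (\<Sum>b\<in>{1..K}. exp (- pmf \<pi> b / 4) ^ n) + \<epsilon>"
proof -
  let ?M = "Pi_pmf {..<n} 0 (\<lambda>_. \<pi>)"
  let ?N = "\<lambda>Z. Pi_pmf (node_pairs n) False (\<lambda>(i, j). bernoulli_pmf (P (Z i) (Z j)))"
  define G where "G = {Z. \<forall>b\<in>{1..K}. real (n_cnt n Z b) \<ge> \<nu> * real n}"
  have "measure_pmf.prob (sbm_pmf \<pi> P n) {(Z, E). \<not> perm_diag K n (est n E) Z}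
      = measure_pmf.prob (bind_pmf ?M (\<lambda>Z. map_pmf (Pair Z) (?N Z))) {(Z, E). \<not> perm_diag K n (est n E) Z}"
    by (simp add: sbm_pmf_def map_pmf_def node_pairs_def)
  also have "\<dots> \<le> measure_pmf.prob ?M (- G) + \<epsilon>"
  proof (rule prob_bind_pmf_le[OF _ \<epsilon>])
    fix Z assume Z: "Z \<in> set_pmf ?M" "Z \<in> G"
    have "Z \<in> labellings K n"
      using Z(1) \<pi> by (force simp: set_Pi_pmf labellings_def PiE_dflt_def)
    with Z(2) have "measure_pmf.prob (?N Z) {E. \<not> perm_diag K n (est n E) Z} \<le> \<epsilon>"
      by (intro cond) (auto simp: G_def)
    moreover have "Pair Z -` {(Z, E). \<not> perm_diag K n (est n E) Z} = {E. \<not> perm_diag K n (est n E) Z}"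
      by auto
    ultimately show "measure_pmf.prob (map_pmf (Pair Z) (?N Z)) {(Z, E). \<not> perm_diag K n (est n E) Z} \<le> \<epsilon>"
      by simp
  qed
  also have "measure_pmf.prob ?M (- G) \<le> (\<Sum>b\<in>{1..K}. exp (- pmf \<pi> b / 4) ^ n)"
  proof -
    have "- G = (\<Union>b\<in>{1..K}. {Z. real (n_cnt n Z b) < \<nu> * real n})"
      by (auto simp: G_def not_le)
    then have "measure_pmf.prob ?M (- G) \<le> (\<Sum>b\<in>{1..K}. measure_pmf.prob ?M {Z. real (n_cnt n Z b) < \<nu> * real n})"
      by (simp only:) (rule measure_pmf.finite_measure_subadditive_finite, auto)
    also have "\<dots> \<le> (\<Sum>b\<in>{1..K}. exp (- pmf \<pi> b / 4) ^ n)"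
      by (intro sum_mono prob_n_cnt_small_le \<nu>)
    finally show ?thesis .
  qed
  finally show ?thesis by simp
qed

text \<open>The least positive value among finitely many squared differences. Inserting 1 keeps the
  minimum defined when there are none, as for a single class.\<close>

lemma exists_uniform_row_gap:
  assumes "\<And>a a'. a \<in> A \<Longrightarrow> a' \<in> A \<Longrightarrow> a \<noteq> a' \<Longrightarrow> \<exists>c\<in>A. S a c \<noteq> (S a' c :: real)" "finite A"
  shows "\<exists>\<delta>>0. \<forall>a\<in>A. \<forall>a'\<in>A. a \<noteq> a' \<longrightarrow> (\<exists>c\<in>A. (sqrt (S a c) - sqrt (S a' c))\<^sup>2 \<ge> \<delta>)"
proof -
  define h where "h = (\<lambda>(a, a', c). (sqrt (S a c) - sqrt (S a' c))\<^sup>2)"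
  define F where "F = {v \<in> h ` (A \<times> A \<times> A). v > 0}"
  have F: "finite (insert 1 F)" using assms(2) by (simp add: F_def)
  define \<delta> where "\<delta> = Min (insert 1 F)"
  have "\<delta> > 0" unfolding \<delta>_def using F by (subst Min_gr_iff) (auto simp: F_def)
  moreover have "\<exists>c\<in>A. (sqrt (S a c) - sqrt (S a' c))\<^sup>2 \<ge> \<delta>" if a: "a \<in> A" "a' \<in> A" "a \<noteq> a'" for a a'
  proof -
    obtain c where c: "c \<in> A" "S a c \<noteq> S a' c" using assms(1) a by blast
    have "h (a, a', c) \<in> h ` (A \<times> A \<times> A)"
      using a c(1) by (intro imageI) auto
    moreover have "h (a, a', c) > 0" using c(2) by (simp add: h_def)
    ultimately have "h (a, a', c) \<in> F" by (simp add: F_def)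
    then have "\<delta> \<le> h (a, a', c)" unfolding \<delta>_def using F by (intro Min_le) auto
    then show ?thesis using c by (auto simp: h_def)
  qed
  ultimately show ?thesis by blast
qed

text \<open>Every polynomial base is bounded by a power of \<open>n\<close>: cubes for
  \<open>n\<^sup>2\<close> plus a constant, \<open>n\<close> for \<open>B0\<close>, a square for
  \<open>n + c\<close>. The summands of \<open>p\<close> come from the leading \<open>n\<close>, the
  grid, the Beta comparison and the Gamma comparison, in this order.\<close>

lemma poly_mult_exp_le_inverse:
  fixes B0 c :: real
  assumes n: "n \<ge> 3" "real n \<ge> B0" "real n \<ge> c + 1" "n \<ge> 2 * C + 2" and B0: "B0 \<ge> 0" and c: "c \<ge> 0"
    and p: "p = 1 + 6 * K\<^sup>2 + (3 * (2 * C + 1) + 1) * K\<^sup>2 + 2 * K"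
    and z: "z \<ge> (real p + 1) * (ln (real n))\<^sup>2"
  shows "real n * (real (n\<^sup>2 + 1) ^ (2 * K\<^sup>2)
      * ((real (n\<^sup>2 + (2 * C + 1)) ^ (2 * C + 1) * B0) ^ (K\<^sup>2) * (real n + c) ^ K) * exp (- z)) \<le> 1 / real n"
proof -
  have n0: "real n > 0" using n by simp
  have cube: "n\<^sup>2 + k \<le> n ^ 3" if "k + 1 \<le> n" for k
  proof -
    have "n\<^sup>2 + k \<le> n\<^sup>2 + k * n\<^sup>2" using n by simp
    also have "\<dots> = (k + 1) * n\<^sup>2" by simp
    also have "\<dots> \<le> n * n\<^sup>2" using that by (intro mult_right_mono) auto
    also have "\<dots> = n ^ 3" by (simp add: power3_eq_cube power2_eq_square)
    finally show ?thesis .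
  qed
  have 1: "real (n\<^sup>2 + 1) \<le> real n ^ 3" "real (n\<^sup>2 + (2 * C + 1)) \<le> real n ^ 3"
    using cube[of 1] cube[of "2 * C + 1"] n unfolding of_nat_power[symmetric] of_nat_le_iff by auto
  have 2: "real n + c \<le> real n ^ 2"
  proof -
    have "real n + c \<le> real n + c * real n" using n c mult_left_mono[of 1 "real n" c] by simp
    also have "\<dots> = (c + 1) * real n" by (simp add: algebra_simps)
    also have "\<dots> \<le> real n * real n" using n by (intro mult_right_mono) auto
    finally show ?thesis by (simp add: power2_eq_square)
  qed
  have "real (n\<^sup>2 + 1) ^ (2 * K\<^sup>2) * ((real (n\<^sup>2 + (2 * C + 1)) ^ (2 * C + 1) * B0) ^ (K\<^sup>2) * (real n + c) ^ K)
      \<le> (real n ^ 3) ^ (2 * K\<^sup>2) * (((real n ^ 3) ^ (2 * C + 1) * real n) ^ (K\<^sup>2) * (real n ^ 2) ^ K)"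
    using 1 2 n B0 c by (intro mult_mono power_mono mult_nonneg_nonneg zero_le_power) auto
  then have "real n * (real (n\<^sup>2 + 1) ^ (2 * K\<^sup>2)
      * ((real (n\<^sup>2 + (2 * C + 1)) ^ (2 * C + 1) * B0) ^ (K\<^sup>2) * (real n + c) ^ K) * exp (- z))
      \<le> real n * ((real n ^ 3) ^ (2 * K\<^sup>2) * (((real n ^ 3) ^ (2 * C + 1) * real n) ^ (K\<^sup>2) * (real n ^ 2) ^ K) * exp (- z))"
    by (intro mult_left_mono mult_right_mono) auto
  also have "\<dots> = real n ^ p * exp (- z)"
  proof -
    have 3: "(real n ^ 3) ^ (2 * K\<^sup>2) = real n ^ (6 * K\<^sup>2)" by (simp add: power_mult[symmetric])
    have 4: "(real n ^ 3) ^ (2 * C + 1) * real n = real n ^ (3 * (2 * C + 1) + 1)"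
      by (simp only: power_add power_mult power_one_right)
    show ?thesis unfolding 3 4 p by (simp only: power_add power_mult power_one_right mult.assoc)
  qed
  also have "\<dots> = exp (real p * ln (real n) - z)"
    using n0 by (simp add: exp_diff exp_minus exp_of_nat_mult field_simps)
  also have "\<dots> \<le> exp (- ln (real n))"
  proof -
    \<comment> \<open>This uses \<open>n \<ge> 3 \<ge> e\<close>. It lets the squared logarithm in
      \<open>z\<close> dominate both \<open>p * ln n\<close> and the extra \<open>ln n\<close> of
      the target.\<close>
    have "ln (real n) \<ge> 1"
      using n exp_le by (subst ln_ge_iff) auto
    then have "(real p + 1) * ln (real n) \<le> (real p + 1) * (ln (real n))\<^sup>2"
      by (intro mult_left_mono) (auto simp: power2_eq_square)
    then show ?thesis using z by (simp add: algebra_simps)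
  qed
  also have "\<dots> = 1 / real n" using n0 by (simp add: exp_minus inverse_eq_divide)
  finally show ?thesis .
qed

lemma strongly_consistent_scaled:
  fixes S :: "nat \<Rightarrow> nat \<Rightarrow> real" and \<rho> :: "nat \<Rightarrow> real"
  assumes K: "K \<ge> 1" and \<alpha>: "\<alpha> > 0" and \<beta>: "\<beta>1 > 0" "\<beta>2 > 0"
    and \<pi>: "set_pmf \<pi> \<subseteq> {1..K}" "\<forall>a\<in>{1..K}. pmf \<pi> a > 0"
    and S: "symmetric_on K S" "\<forall>a\<in>{1..K}. \<forall>b\<in>{1..K}. 0 < S a b" "identifiable K S \<pi>"
    and \<rho>: "\<forall>n. \<rho> n > 0 \<and> (\<forall>a\<in>{1..K}. \<forall>b\<in>{1..K}. \<rho> n * S a b \<le> 1)"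
    and lim: "filterlim (\<lambda>n. (real n - 1) * (\<Sum>a=1..K. \<Sum>b=1..K. pmf \<pi> a * pmf \<pi> b * (\<rho> n * S a b))
                        / (ln (real n))^2) at_top sequentially"
    and est: "QB_maximizer K \<alpha> \<beta>1 \<beta>2 est"
  shows "strongly_consistent K \<pi> (\<lambda>n a b. \<rho> n * S a b) est"
proof -
  define \<nu> where "\<nu> = Min ((\<lambda>b. pmf \<pi> b / 4) ` {1..K})"
  have \<nu>_le: "\<nu> \<le> pmf \<pi> b / 4" if "b \<in> {1..K}" for b
    unfolding \<nu>_def using that by (intro Min_le) auto
  have \<nu>: "\<nu> > 0" "\<nu> \<le> 1"
  proof -
    show "\<nu> > 0" unfolding \<nu>_def using \<pi>(2) K by (subst Min_gr_iff) auto
    show "\<nu> \<le> 1" using \<nu>_le[of 1] K pmf_le_1[of \<pi> 1] by simp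
  qed
  obtain \<delta> where \<delta>: "\<delta> > 0"
    "\<And>a a'. a \<in> {1..K} \<Longrightarrow> a' \<in> {1..K} \<Longrightarrow> a \<noteq> a' \<Longrightarrow> \<exists>c\<in>{1..K}. (sqrt (S a c) - sqrt (S a' c))\<^sup>2 \<ge> \<delta>"
    using exists_uniform_row_gap[of "{1..K}" S] S(2,3) unfolding identifiable_def by blast
  define s where "s = (\<Sum>a=1..K. \<Sum>b=1..K. pmf \<pi> a * pmf \<pi> b * S a b)"
  have s: "s > 0"
    unfolding s_def using \<pi>(2) S(2) K by (intro sum_pos mult_pos_pos) auto
  have lam: "(\<Sum>a=1..K. \<Sum>b=1..K. pmf \<pi> a * pmf \<pi> b * (\<rho> n * S a b)) = \<rho> n * s" for n
    by (simp add: s_def sum_distrib_left mult_ac)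
  define C where "C = nat \<lceil>\<beta>1 + \<beta>2\<rceil>"
  have C: "\<beta>1 \<le> real (Suc C)" "\<beta>2 \<le> real (Suc C)"
    using \<beta> unfolding C_def by linarith+
  define B0 where "B0 = max 1 (Beta \<beta>1 \<beta>2)"
  have B0: "1 \<le> B0" "Beta \<beta>1 \<beta>2 \<le> B0" by (auto simp: B0_def)
  \<comment> \<open>One summand for each of the three lower bounds required of \<open>L\<close>,
    which is taken to be \<open>n + c\<close>.\<close>
  define c where "c = \<alpha> + 1 / \<alpha> + 1"
  have c: "c \<ge> 0" using \<alpha> by (simp add: c_def)
  have L: "real n + \<alpha> \<le> real n + c" "1 / \<alpha> \<le> real n + c" "1 \<le> real n + c" for n
    using \<alpha> by (auto simp: c_def)
  define \<kappa> where "\<kappa> = (\<nu> / real K)\<^sup>2 * \<delta> / 32"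
  have \<kappa>: "\<kappa> > 0" using \<nu> \<delta> K by (simp add: \<kappa>_def)
  define p where "p = 1 + 6 * K\<^sup>2 + (3 * (2 * C + 1) + 1) * K\<^sup>2 + 2 * K"
  define y where "y n = real (n\<^sup>2 + 1) ^ (2 * K\<^sup>2)
      * ((real (n\<^sup>2 + (2 * C + 1)) ^ (2 * C + 1) * B0) ^ (K\<^sup>2) * (real n + c) ^ K)
      * exp (- ((\<nu> / real K)\<^sup>2 * (\<rho> n * \<delta>) / 32 * real n))" for n
  have y0: "y n \<ge> 0" for n using B0 c by (simp add: y_def)
  define N where "N = real (card {\<sigma>. \<sigma> permutes {1..K}})"
  define bad where "bad n = measure_pmf.prob (sbm_pmf \<pi> (\<lambda>a b. \<rho> n * S a b) n) {(Z, E). \<not> perm_diag K n (est n E) Z}" for n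
  have ev_bad: "eventually (\<lambda>n. bad n \<le> (\<Sum>b\<in>{1..K}. exp (- pmf \<pi> b / 4) ^ n) + N * ((1 + real K * y n) ^ n - 1)) sequentially"
    using eventually_ge_at_top[of "nat \<lceil>2 * real K / \<nu>\<rceil>"]
  proof eventually_elim
    case (elim n)
    then have "2 * real K / \<nu> \<le> real n" by linarith
    then have large: "\<nu> / real K * real n \<ge> 2" using \<nu> K by (simp add: field_simps)
    have "(1 + real K * y n) ^ n \<ge> 1" using y0 by (intro one_le_power) simp
    then have nonneg: "N * ((1 + real K * y n) ^ n - 1) \<ge> 0" by (simp add: N_def)
    \<comment> \<open>The factor \<open>\<rho> n\<close> comes out of the squared difference of
      roots, so the gap shrinks only linearly with the density.\<close>
    have gap: "\<exists>c\<in>{1..K}. (sqrt (\<rho> n * S a c) - sqrt (\<rho> n * S a' c))\<^sup>2 \<ge> \<rho> n * \<delta>"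
      if a: "a \<in> {1..K}" "a' \<in> {1..K}" "a \<noteq> a'" for a a'
    proof -
      obtain c where c: "c \<in> {1..K}" "(sqrt (S a c) - sqrt (S a' c))\<^sup>2 \<ge> \<delta>" using \<delta>(2)[OF a] by blast
      have "(sqrt (\<rho> n * S a c) - sqrt (\<rho> n * S a' c))\<^sup>2 = \<rho> n * (sqrt (S a c) - sqrt (S a' c))\<^sup>2"
        using \<rho> by (simp add: real_sqrt_mult right_diff_distrib[symmetric] power_mult_distrib less_imp_le)
      also have "\<dots> \<ge> \<rho> n * \<delta>" using c \<rho> by (intro mult_left_mono) (auto simp: less_imp_le)
      finally show ?thesis using c by blast
    qed
    have P: "0 \<le> \<rho> n * S a b \<and> \<rho> n * S a b \<le> 1" if "a \<in> {1..K}" "b \<in> {1..K}" for a b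
      using that \<rho> S(2) by (simp add: less_imp_le)
    have sym: "symmetric_on K (\<lambda>a b. \<rho> n * S a b)" using S(1) by (simp add: symmetric_on_def)
    have \<rho>\<delta>: "\<rho> n * \<delta> > 0" using \<rho> \<delta> by simp
    show ?case unfolding bad_def N_def
      by (rule prob_sbm_not_perm_diag_le[OF K \<pi>(1) \<nu>_le nonneg[unfolded N_def]])
        (assumption, rule prob_not_perm_diag_le[OF K \<alpha> \<beta> C B0 L P sym \<rho>\<delta> gap \<nu> _ large _ est y_def])
  qed
  have ev_y: "eventually (\<lambda>n. real n * y n \<le> 1 / real n) sequentially"
  proof -
    \<comment> \<open>The threshold is chosen so that, after cancelling \<open>s\<close>, the
      exponent \<open>\<kappa> * n * \<rho> n\<close> is at least
      \<open>(p + 1) * (ln n)\<^sup>2\<close>.\<close>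
    have "eventually (\<lambda>n. (real n - 1) * (\<rho> n * s) / (ln (real n))\<^sup>2 \<ge> (real p + 1) * s / \<kappa>) sequentially"
      using lim unfolding lam filterlim_at_top by blast
    then show ?thesis
      using eventually_ge_at_top[of "3 + nat \<lceil>B0\<rceil> + nat \<lceil>c + 1\<rceil> + (2 * C + 2)"]
    proof eventually_elim
      case (elim n)
      have n: "n \<ge> 3" "real n \<ge> B0" "real n \<ge> c + 1" "n \<ge> 2 * C + 2"
        using elim(2) by linarith+
      have ln: "ln (real n) > 0" using n by simp
      have "(real p + 1) * s / \<kappa> * (ln (real n))\<^sup>2 \<le> (real n - 1) * (\<rho> n * s)"
        using elim(1) ln by (simp add: le_divide_eq)
      then have "(real p + 1) * (ln (real n))\<^sup>2 * s \<le> (\<kappa> * ((real n - 1) * \<rho> n)) * s"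
        using \<kappa> by (simp add: field_simps)
      then have "(real p + 1) * (ln (real n))\<^sup>2 \<le> \<kappa> * ((real n - 1) * \<rho> n)"
        using s by simp
      also have "\<dots> \<le> \<kappa> * (real n * \<rho> n)"
        using \<kappa> \<rho> by (intro mult_left_mono mult_right_mono) (auto simp: less_imp_le)
      also have "\<dots> = (\<nu> / real K)\<^sup>2 * (\<rho> n * \<delta>) / 32 * real n" by (simp add: \<kappa>_def)
      finally show ?case
        unfolding y_def using B0 by (intro poly_mult_exp_le_inverse[OF n _ c p_def]) auto
    qed
  qed
  have "bad \<longlonglongrightarrow> 0"
  proof (rule tendsto_sandwich[OF _ _ tendsto_const])
    show "eventually (\<lambda>n. 0 \<le> bad n) sequentially" by (simp add: bad_def)
    \<comment> \<open>As \<open>n * y n\<close> is at most \<open>1 / n\<close>, the power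
      \<open>(1 + K * y n) ^ n\<close> is at most \<open>exp (K / n)\<close>, which tends to
      1.\<close>
    show "eventually (\<lambda>n. bad n \<le> (\<Sum>b\<in>{1..K}. exp (- pmf \<pi> b / 4) ^ n) + N * (exp (real K * (1 / real n)) - 1)) sequentially"
      using ev_bad ev_y
    proof eventually_elim
      case (elim n)
      have "(1 + real K * y n) ^ n \<le> exp (real K * y n) ^ n"
        using y0[of n] by (intro power_mono exp_ge_add_one_self) auto
      also have "\<dots> = exp (real K * (real n * y n))" by (simp add: exp_of_nat_mult[symmetric] mult_ac)
      also have "\<dots> \<le> exp (real K * (1 / real n))"
        using elim(2) by (simp only: exp_le_cancel_iff) (intro mult_left_mono, auto)
      finally have "N * ((1 + real K * y n) ^ n - 1) \<le> N * (exp (real K * (1 / real n)) - 1)"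
        by (intro mult_left_mono) (auto simp: N_def)
      then show ?case using elim(1) by simp
    qed
    have "(\<lambda>n. (\<Sum>b\<in>{1..K}. exp (- pmf \<pi> b / 4) ^ n) + N * (exp (real K * (1 / real n)) - 1))
        \<longlonglongrightarrow> (\<Sum>b\<in>{1..K}. 0) + N * (exp (real K * 0) - 1)"
      using \<pi>(2) by (intro tendsto_intros lim_1_over_n LIMSEQ_power_zero) auto
    then show "(\<lambda>n. (\<Sum>b\<in>{1..K}. exp (- pmf \<pi> b / 4) ^ n) + N * (exp (real K * (1 / real n)) - 1)) \<longlonglongrightarrow> 0"
      by simp
  qed
  then have "(\<lambda>n. 1 - bad n) \<longlonglongrightarrow> 1 - 0" by (intro tendsto_intros)
  moreover have "1 - bad n = measure_pmf.prob (sbm_pmf \<pi> (\<lambda>a b. \<rho> n * S a b) n) {(Z, E). perm_diag K n (est n E) Z}" for n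
  proof -
    have "{(Z, E). \<not> perm_diag K n (est n E) Z} = UNIV - {(Z, E). perm_diag K n (est n E) Z}" by auto
    then show ?thesis
      unfolding bad_def using measure_pmf.prob_compl[of "{(Z, E). perm_diag K n (est n E) Z}"] by simp
  qed
  ultimately show ?thesis unfolding strongly_consistent_def by simp
qed

theorem theorem3p2:
  fixes K :: nat and \<alpha> \<beta>1 \<beta>2 :: real
  assumes "K \<ge> 1" and "\<alpha> > 0" and "\<beta>1 > 0" and "\<beta>2 > 0"
  shows
   "(\<forall>(\<pi> :: nat pmf) (P :: nat \<Rightarrow> nat \<Rightarrow> real) est.
       set_pmf \<pi> \<subseteq> {1..K} \<and> (\<forall>a\<in>{1..K}. pmf \<pi> a > 0) \<and>
       symmetric_on K P \<and> (\<forall>a\<in>{1..K}. \<forall>b\<in>{1..K}. 0 < P a b \<and> P a b < 1) \<and>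
       identifiable K P \<pi> \<and> QB_maximizer K \<alpha> \<beta>1 \<beta>2 est
       \<longrightarrow> strongly_consistent K \<pi> (\<lambda>_. P) est)
    \<and>
    (\<forall>(\<pi> :: nat pmf) (S :: nat \<Rightarrow> nat \<Rightarrow> real) (\<rho> :: nat \<Rightarrow> real) est.
       set_pmf \<pi> \<subseteq> {1..K} \<and> (\<forall>a\<in>{1..K}. pmf \<pi> a > 0) \<and>
       symmetric_on K S \<and> (\<forall>a\<in>{1..K}. \<forall>b\<in>{1..K}. 0 < S a b) \<and>
       identifiable K S \<pi> \<and>
       (\<forall>n. \<rho> n > 0 \<and> (\<forall>a\<in>{1..K}. \<forall>b\<in>{1..K}. \<rho> n * S a b \<le> 1)) \<and>
       filterlim (\<lambda>n. (real n - 1) * (\<Sum>a=1..K. \<Sum>b=1..K. pmf \<pi> a * pmf \<pi> b * (\<rho> n * S a b))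
                        / (ln (real n))^2) at_top sequentially \<and>
       QB_maximizer K \<alpha> \<beta>1 \<beta>2 est
       \<longrightarrow> strongly_consistent K \<pi> (\<lambda>n a b. \<rho> n * S a b) est)"
proof (intro conjI allI impI; elim conjE)
  fix \<pi> :: "nat pmf" and P :: "nat \<Rightarrow> nat \<Rightarrow> real" and est
  assume \<pi>: "set_pmf \<pi> \<subseteq> {1..K}" "\<forall>a\<in>{1..K}. pmf \<pi> a > 0"
    and P: "symmetric_on K P" "\<forall>a\<in>{1..K}. \<forall>b\<in>{1..K}. 0 < P a b \<and> P a b < 1" "identifiable K P \<pi>"
    and est: "QB_maximizer K \<alpha> \<beta>1 \<beta>2 est"
  define s where "s = (\<Sum>a=1..K. \<Sum>b=1..K. pmf \<pi> a * pmf \<pi> b * P a b)"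
  have "s > 0"
    unfolding s_def using \<pi>(2) P(2) assms(1) by (intro sum_pos mult_pos_pos) auto
  then have "filterlim (\<lambda>n. (real n - 1) * s / (ln (real n))^2) at_top sequentially"
    by real_asymp
  \<comment> \<open>The fixed model is the scaled one with constant density 1; its growth condition
    reduces to \<open>n / (ln n)\<^sup>2\<close> tending to infinity.\<close>
  then have "strongly_consistent K \<pi> (\<lambda>n a b. 1 * P a b) est"
    using \<pi> P est by (intro strongly_consistent_scaled[OF assms]) (auto simp: s_def less_imp_le)
  then show "strongly_consistent K \<pi> (\<lambda>_. P) est" by simp
next
  fix \<pi> :: "nat pmf" and S :: "nat \<Rightarrow> nat \<Rightarrow> real" and \<rho> :: "nat \<Rightarrow> real" and est
  assume "set_pmf \<pi> \<subseteq> {1..K}" "\<forall>a\<in>{1..K}. pmf \<pi> a > 0"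
    "symmetric_on K S" "\<forall>a\<in>{1..K}. \<forall>b\<in>{1..K}. 0 < S a b" "identifiable K S \<pi>"
    "\<forall>n. \<rho> n > 0 \<and> (\<forall>a\<in>{1..K}. \<forall>b\<in>{1..K}. \<rho> n * S a b \<le> 1)"
    "filterlim (\<lambda>n. (real n - 1) * (\<Sum>a=1..K. \<Sum>b=1..K. pmf \<pi> a * pmf \<pi> b * (\<rho> n * S a b))
        / (ln (real n))^2) at_top sequentially"
    "QB_maximizer K \<alpha> \<beta>1 \<beta>2 est"
  then show "strongly_consistent K \<pi> (\<lambda>n a b. \<rho> n * S a b) est"
    by (rule strongly_consistent_scaled[OF assms])
qed

end
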